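(* Let $d\ge 2$. Then $$\inf\{F_q(\Omega)\ :\ \Omega\in\mathcal{A}_{convex}\}=0\qquad\text{for every }q>1/2,$$ $$\sup\{F_q(\Omega)\ :\ \Omega\in\mathcal{A}_{convex}\}=+\infty\qquad\text{for every }0<q<1/2.$$
   Context: $\mathcal{A}_{convex}$ is the class of all nonempty open convex sets $\Omega\subset\mathbb{R}^d$ with finite Lebesgue measure $|\Omega|$. For such $\Omega$: - $P(\Omega)=\sup\{\int_\Omega \mathrm{div}\,\phi\,dx : \phi\in C^1_c(\mathbb{R}^d;\mathbb{R}^d),\ \|\phi\|_{L^\infty(\mathbb{R}^d)}\le 1\}$ is the (De Giorgi) perimeter. - $T(\Omega)=\int_\Omega u\,dx$ is the torsional rigidity, where $u\in H^1_0(\Omega)$ is the unique (weak) solution of $-\Delta u=1$ in $\Omega$. Equivalently, $T(\Omega)=\max\{(\int_\Omega u\,dx)^2(\int_\Omega|\nabla u|^2dx)^{-1} : u\in H^1_0(\Omega)\setminus\{0\}\}$. - For $q>0$, $F_q(\Omega)=\dfrac{P(\Omega)\,T(\Omega)^q}{|\Omega|^{\alpha_q}}$ with $\alpha_q=1+q+\dfrac{2q-1}{d}$. *)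

theory Defs
  imports "HOL-Analysis.Analysis"
begin

text \<open>\<open>C_k k f\<close> says that \<open>f\<close> is of class \<open>C\<^sup>k\<close> on the whole space. In finite dimension, continuity of
  the derivative as a map into the linear operators is the continuity of all directional
  derivatives.\<close>

primrec C_k :: "nat \<Rightarrow> ('a::euclidean_space \<Rightarrow> 'b::euclidean_space) \<Rightarrow> bool" where
  "C_k 0 f \<longleftrightarrow> continuous_on UNIV f"
| "C_k (Suc k) f \<longleftrightarrow> (\<forall>x. f differentiable (at x)) \<and>
     (\<forall>v. C_k k (\<lambda>x. frechet_derivative f (at x) v))"

definition supp :: "('a::topological_space \<Rightarrow> 'b::zero) \<Rightarrow> 'a set" where
  "supp f = closure {x. f x \<noteq> 0}"

definition divergence :: "('a::euclidean_space \<Rightarrow> 'a) \<Rightarrow> 'a \<Rightarrow> real" where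
  "divergence \<phi> x = (\<Sum>b\<in>Basis. frechet_derivative \<phi> (at x) b \<bullet> b)"

definition gradient :: "('a::euclidean_space \<Rightarrow> real) \<Rightarrow> 'a \<Rightarrow> 'a" where
  "gradient f x = (\<Sum>b\<in>Basis. frechet_derivative f (at x) b *\<^sub>R b)"

text \<open>The De Giorgi perimeter may be infinite for a general set, hence the extended reals.
  The almost-everywhere bound is the condition that the \<open>L\<^sup>\<infinity>\<close> norm be at most one.\<close>

definition perimeter :: "'a::euclidean_space set \<Rightarrow> ereal" where
  "perimeter \<Omega> =
     (SUP \<phi> \<in> {\<phi> :: 'a \<Rightarrow> 'a. C_k 1 \<phi> \<and> compact (supp \<phi>) \<and> (AE x in lebesgue. norm (\<phi> x) \<le> 1)}.
        ereal (LINT x|lebesgue_on \<Omega>. divergence \<phi> x))"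

definition test_functions :: "'a::euclidean_space set \<Rightarrow> ('a \<Rightarrow> real) set" where
  "test_functions \<Omega> = {\<phi>. (\<forall>k. C_k k \<phi>) \<and> compact (supp \<phi>) \<and> supp \<phi> \<subseteq> \<Omega>}"

text \<open>Elements of \<open>L\<^sup>2\<close> and of the Sobolev spaces are represented by functions on the whole space
  of which only the restriction to \<open>\<Omega>\<close>, up to null sets, matters.\<close>

definition L2 :: "'a::euclidean_space set \<Rightarrow> ('a \<Rightarrow> 'b::euclidean_space) set" where
  "L2 \<Omega> = {f. f \<in> borel_measurable (lebesgue_on \<Omega>) \<and>
     integrable (lebesgue_on \<Omega>) (\<lambda>x. (norm (f x))\<^sup>2)}"

text \<open>This says that \<open>u\<close> belongs to \<open>H\<^sup>1(\<Omega>)\<close> and that \<open>g\<close> is its distributional gradient.\<close>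

definition has_weak_gradient :: "'a::euclidean_space set \<Rightarrow> ('a \<Rightarrow> real) \<Rightarrow> ('a \<Rightarrow> 'a) \<Rightarrow> bool" where
  "has_weak_gradient \<Omega> u g \<longleftrightarrow> u \<in> L2 \<Omega> \<and> g \<in> L2 \<Omega> \<and>
     (\<forall>\<phi> \<in> test_functions \<Omega>. \<forall>b \<in> Basis.
        (LINT x|lebesgue_on \<Omega>. u x * frechet_derivative \<phi> (at x) b) =
        - (LINT x|lebesgue_on \<Omega>. (g x \<bullet> b) * \<phi> x))"

text \<open>The closure of the test functions in \<open>H\<^sup>1(\<Omega>)\<close>.\<close>

definition H1_0 :: "'a::euclidean_space set \<Rightarrow> ('a \<Rightarrow> real) set" where
  "H1_0 \<Omega> = {u. \<exists>g. has_weak_gradient \<Omega> u g \<and>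
     (\<exists>\<phi>. (\<forall>n. \<phi> n \<in> test_functions \<Omega>) \<and>
        (\<lambda>n. (LINT x|lebesgue_on \<Omega>. (\<phi> n x - u x)\<^sup>2) +
             (LINT x|lebesgue_on \<Omega>. (norm (gradient (\<phi> n) x - g x))\<^sup>2)) \<longlonglongrightarrow> 0)}"

text \<open>Weak solutions in \<open>H\<^sup>1\<^sub>0(\<Omega>)\<close> of \<open>-\<Delta>u = 1\<close>. Weak gradients are unique only up to null sets;
  \<open>g\<close> and \<open>h\<close> are representatives of the gradients of \<open>u\<close> and \<open>v\<close>, and the integrals do not
  depend on their choice.\<close>

definition torsion_function :: "'a::euclidean_space set \<Rightarrow> ('a \<Rightarrow> real) \<Rightarrow> bool" where
  "torsion_function \<Omega> u \<longleftrightarrow> u \<in> H1_0 \<Omega> \<and>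
     (\<exists>g. has_weak_gradient \<Omega> u g \<and>
        (\<forall>v \<in> H1_0 \<Omega>. \<forall>h. has_weak_gradient \<Omega> v h \<longrightarrow>
           (LINT x|lebesgue_on \<Omega>. g x \<bullet> h x) = (LINT x|lebesgue_on \<Omega>. v x)))"

text \<open>The weak solution is unique as an element of \<open>H\<^sup>1\<^sub>0(\<Omega>)\<close>, that is, up to null sets;
  its integral is therefore a unique number.\<close>

definition torsional_rigidity :: "'a::euclidean_space set \<Rightarrow> real" where
  "torsional_rigidity \<Omega> =
     (THE t. \<exists>u. torsion_function \<Omega> u \<and> t = (LINT x|lebesgue_on \<Omega>. u x))"

definition A_convex :: "'a::euclidean_space set set" where
  "A_convex = {\<Omega>. \<Omega> \<noteq> {} \<and> open \<Omega> \<and> convex \<Omega> \<and> emeasure lebesgue \<Omega> < \<infinity>}"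

definition F :: "real \<Rightarrow> 'a::euclidean_space set \<Rightarrow> ereal" where
  "F q \<Omega> = perimeter \<Omega> * ereal (torsional_rigidity \<Omega> powr q) /
     ereal (measure lebesgue \<Omega> powr (1 + q + (2 * q - 1) / real DIM('a)))"

end

theory Submission
  imports Defs
begin

text \<open>On an ellipsoid \<open>Q x < 1\<close> with \<open>Q x = \<Sum>\<^sub>b (x\<^sub>b / a\<^sub>b)\<^sup>2\<close> the torsion function is explicit:
  \<open>u = (1 - Q) / (2 \<Sum>\<^sub>b a\<^sub>b\<^sup>-\<^sup>2)\<close>. Shrink one semi-axis of the unit ball to \<open>\<epsilon>\<close>. Then the volume is of
  order \<open>\<epsilon>\<close>, the torsional rigidity of order \<open>\<epsilon>\<^sup>3\<close>, and the perimeter stays between two positive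
  constants, so that \<open>F\<^sub>q\<close> is of order \<open>\<epsilon>\<close> to the power \<open>(2q - 1)(1 - 1/d)\<close>. This exponent has the sign
  of \<open>q - 1/2\<close>; let \<open>\<epsilon> \<rightarrow> 0\<close>.\<close>

section \<open>Functions of class \<open>C\<^sup>k\<close>\<close>

text \<open>The explicit formula moves the work elsewhere. \<open>H1_0\<close> is a closure of test
  functions, so the formula has to be approximated by smooth functions with compact support inside
  the ellipsoid; since \<open>quad\<close> is a polynomial, profiles of the single quantity
  \<open>quad a x\<close> do this and keep all gradients parallel to that of \<open>quad\<close>.
  The weak equation must then hold for every element of \<open>H1_0\<close> and every representative
  of its gradient, which calls for a small uniqueness argument. The perimeter is never computed. One
  vector field bounds it from below, but an upper bound has to treat all admissible fields at once;
  it comes from volumes of translates and dilates instead of a surface integral. The limit of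
  difference quotients used for this also gives integration by parts. Constants may be crude, since
  only powers of \<open>\<epsilon>\<close> decide the limit. The assumption \<open>d \<ge> 2\<close>
  makes the factor \<open>1 - 1/d\<close> of the exponent positive.\<close>

lemma C_k_SucI:
  assumes "\<And>x. (f has_derivative f' x) (at x)" and "\<And>v. C_k k (\<lambda>x. f' x v)"
  shows "C_k (Suc k) f"
proof -
  have "frechet_derivative f (at x) = f' x" for x
    using frechet_derivative_at[OF assms(1)] by simp
  then show ?thesis using assms by (auto simp: differentiable_def)
qed

lemma C_k_Suc_has_derivative:
  "C_k (Suc k) f \<Longrightarrow> (f has_derivative frechet_derivative f (at x)) (at x)"
  by (simp add: frechet_derivative_works)

lemma C_k_Suc_imp_C_k: "C_k (Suc k) f \<Longrightarrow> C_k k f"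
proof (induction k arbitrary: f)
  case 0
  then show ?case
    by (auto intro!: continuous_at_imp_continuous_on differentiable_imp_continuous_within)
next
  case (Suc k)
  then show ?case by (metis C_k.simps(2))
qed

lemma C_k_continuous_on: "C_k k f \<Longrightarrow> continuous_on S f"
proof (induction k)
  case 0
  then show ?case by (auto intro: continuous_on_subset)
qed (use C_k_Suc_imp_C_k in blast)

lemma C_k_const: "C_k k (\<lambda>x. c)"
proof (induction k arbitrary: c)
  case (Suc k)
  show ?case by (rule C_k_SucI[where f' = "\<lambda>x v. 0"]) (auto intro: Suc)
qed simp

lemma C_k_bounded_linear_compose:
  assumes "bounded_linear L"
  shows "C_k k f \<Longrightarrow> C_k k (\<lambda>x. L (f x))"
proof (induction k arbitrary: f)
  case 0
  then show ?case using bounded_linear.continuous_on[OF assms] by auto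
next
  case (Suc k)
  have "((\<lambda>x. L (f x)) has_derivative (\<lambda>v. L (frechet_derivative f (at x) v))) (at x)" for x
    by (rule bounded_linear.has_derivative[OF assms C_k_Suc_has_derivative[OF Suc.prems]])
  with Suc show ?case
    by (intro C_k_SucI[where f' = "\<lambda>x v. L (frechet_derivative f (at x) v)"]) auto
qed

lemma C_k_linear: "bounded_linear L \<Longrightarrow> C_k k L"
proof (induction k)
  case 0
  then show ?case by (simp add: linear_continuous_on)
next
  case (Suc k)
  then show ?case
    by (intro C_k_SucI[where f' = "\<lambda>x. L"])
      (auto intro: C_k_const bounded_linear_imp_has_derivative)
qed

lemma C_k_add: "C_k k f \<Longrightarrow> C_k k g \<Longrightarrow> C_k k (\<lambda>x. f x + g x)"
proof (induction k arbitrary: f g)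
  case 0
  then show ?case by (simp add: continuous_on_add continuous_on_mult)
next
  case (Suc k)
  have "((\<lambda>x. f x + g x) has_derivative
      (\<lambda>v. frechet_derivative f (at x) v + frechet_derivative g (at x) v)) (at x)" for x
    by (rule has_derivative_add[OF C_k_Suc_has_derivative[OF Suc.prems(1)] C_k_Suc_has_derivative[OF Suc.prems(2)]])
  with Suc show ?case
    by (intro C_k_SucI[where f' = "\<lambda>x v. frechet_derivative f (at x) v + frechet_derivative g (at x) v"])
      auto
qed

text \<open>The product rule leaves one factor of each summand undifferentiated;
  \<open>C_k_Suc_imp_C_k\<close> lowers that factor to order \<open>k\<close>, so that the induction
  hypothesis covers both products.\<close>

lemma C_k_mult:
  fixes f g :: "'a::euclidean_space \<Rightarrow> real"
  shows "C_k k f \<Longrightarrow> C_k k g \<Longrightarrow> C_k k (\<lambda>x. f x * g x)"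
proof (induction k arbitrary: f g)
  case 0
  then show ?case by (simp add: continuous_on_add continuous_on_mult)
next
  case (Suc k)
  show ?case
  proof (rule C_k_SucI)
    fix x
    show "((\<lambda>x. f x * g x) has_derivative
        (\<lambda>v. f x * frechet_derivative g (at x) v + frechet_derivative f (at x) v * g x)) (at x)"
      using C_k_Suc_has_derivative[OF Suc.prems(1)] C_k_Suc_has_derivative[OF Suc.prems(2)]
      by (rule has_derivative_mult)
  next
    fix v
    show "C_k k (\<lambda>x. f x * frechet_derivative g (at x) v + frechet_derivative f (at x) v * g x)"
      using Suc.prems C_k_Suc_imp_C_k[OF Suc.prems(1)] C_k_Suc_imp_C_k[OF Suc.prems(2)]
      by (intro C_k_add Suc.IH) simp_all
  qed
qed

lemma C_k_cmult:
  fixes f :: "'a::euclidean_space \<Rightarrow> real"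
  shows "C_k k f \<Longrightarrow> C_k k (\<lambda>x. c * f x)"
  by (intro C_k_mult C_k_const)

lemma C_k_sum: "finite I \<Longrightarrow> (\<And>i. i \<in> I \<Longrightarrow> C_k k (f i)) \<Longrightarrow> C_k k (\<lambda>x. \<Sum>i\<in>I. f i x)"
  by (induction I rule: finite_induct) (auto intro: C_k_const C_k_add)

lemma frechet_derivative_eq_0_outside_supp:
  assumes "x \<notin> supp f"
  shows "frechet_derivative f (at x) = (\<lambda>v. 0)"
proof -
  have "open (- supp f)" by (simp add: supp_def open_closed)
  moreover have "0 = f y" if "y \<in> - supp f" for y
    using that closure_subset[of "{x. f x \<noteq> 0}"] by (auto simp: supp_def)
  ultimately have "(f has_derivative (\<lambda>v. 0)) (at x)"
    using assms has_derivative_transform_within_open[of "\<lambda>x. 0" "\<lambda>v. 0" x UNIV "- supp f" f] by auto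
  from frechet_derivative_at[OF this] show ?thesis by simp
qed

lemma eq_0_outside_supp: "x \<notin> supp f \<Longrightarrow> f x = 0"
  using closure_subset[of "{x. f x \<noteq> 0}"] by (auto simp: supp_def)

lemma compact_supp_subset:
  assumes "supp f \<subseteq> K" "compact K"
  shows "compact (supp f)"
proof -
  have "compact (K \<inter> supp f)" using assms(2) by (rule compact_Int_closed) (simp add: supp_def)
  then show ?thesis using assms(1) by (simp add: Int_absorb1)
qed

lemma gradient_inner: "b \<in> Basis \<Longrightarrow> gradient f x \<bullet> b = frechet_derivative f (at x) b"
  by (simp add: gradient_def)

lemma continuous_gradient:
  assumes "C_k 1 f"
  shows "continuous_on UNIV (gradient f)"
  unfolding gradient_def[abs_def] using assms by (auto intro!: continuous_intros)

lemma test_functions_C_k: "\<phi> \<in> test_functions S \<Longrightarrow> C_k k \<phi>"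
  by (simp add: test_functions_def)

section \<open>A smooth function vanishing on the negative half-line\<close>

text \<open>The powers in the denominator make the family closed under differentiation: the
  derivative of member \<open>m\<close> combines members \<open>m + 1\<close> and
  \<open>m + 2\<close>, so one induction with \<open>m\<close> arbitrary gives smoothness. As
  \<open>\<delta>\<close> tends to 0, \<open>flat \<delta> 0\<close> tends to the indicator of the
  positive half-line, which is what a cutoff needs.\<close>

definition flat :: "real \<Rightarrow> nat \<Rightarrow> real \<Rightarrow> real" where
  "flat \<delta> m t = (if t > 0 then exp (- \<delta> / t) / t ^ m else 0)"

lemma flat_nonneg: "flat \<delta> m t \<ge> 0"
  by (simp add: flat_def)

lemma flat_0_le_1: "\<delta> > 0 \<Longrightarrow> flat \<delta> 0 t \<le> 1"
  by (simp add: flat_def)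

text \<open>The exponential beats every power: \<open>exp (\<delta> / t)\<close> is at least
  \<open>(1 + \<delta> / (k * t)) ^ k\<close>. A quadratic bound is enough for the derivative at 0
  to exist and vanish.\<close>

lemma flat_le_square:
  assumes "\<delta> > 0"
  obtains C where "\<And>t. flat \<delta> m t \<le> C * t\<^sup>2"
proof
  \<comment> \<open>After division by \<open>t ^ m\<close>, exactly the square of \<open>t\<close>
    remains.\<close>
  define k where "k = m + 2"
  fix t :: real
  show "flat \<delta> m t \<le> (real k / \<delta>) ^ k * t\<^sup>2"
  proof (cases "t > 0")
    case True
    have "(\<delta> / (k * t)) ^ k \<le> (1 + (\<delta> / t) / k) ^ k"
      using True assms by (intro power_mono) (simp_all add: mult.commute)
    also have "\<dots> \<le> exp (\<delta> / t)"
      using True assms by (intro exp_ge_one_plus_x_over_n_power_n) (auto simp: k_def intro: order_trans[of _ 0])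
    finally have "inverse (exp (\<delta> / t)) \<le> inverse ((\<delta> / (k * t)) ^ k)"
      using True assms by (intro le_imp_inverse_le zero_less_power) (simp_all add: k_def)
    then have "exp (- \<delta> / t) \<le> inverse ((\<delta> / (k * t)) ^ k)"
      by (simp add: exp_minus)
    also have "inverse ((\<delta> / (k * t)) ^ k) = (real k / \<delta> * t) ^ k"
      by (simp flip: power_inverse)
    also have "\<dots> = (real k / \<delta>) ^ k * t ^ k"
      by (rule power_mult_distrib)
    also have "\<dots> = (real k / \<delta>) ^ k * t\<^sup>2 * t ^ m"
      by (simp add: k_def power_add power2_eq_square mult_ac)
    finally show ?thesis using True by (simp add: flat_def divide_le_eq)
  qed (use assms in \<open>simp add: flat_def\<close>)
qed

lemma flat_has_real_derivative:
  assumes "\<delta> > 0"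
  shows "(flat \<delta> m has_real_derivative \<delta> * flat \<delta> (m + 2) t - m * flat \<delta> (m + 1) t) (at t)"
proof (cases t "0::real" rule: linorder_cases)
  case less
  have "(flat \<delta> m has_real_derivative 0) (at t)"
    by (rule has_field_derivative_transform_within_open[of "\<lambda>t. 0" 0 t "{..<0}"])
      (use less in \<open>auto simp: flat_def\<close>)
  then show ?thesis using less by (simp add: flat_def)
next
  case equal
  obtain C where C: "\<And>t. flat \<delta> m t \<le> C * t\<^sup>2" using flat_le_square[OF assms] by metis
  \<comment> \<open>The quadratic bound makes the difference quotient at most
    \<open>C * \<bar>h\<bar>\<close>.\<close>
  have "((\<lambda>h. flat \<delta> m h / h) \<longlongrightarrow> 0) (at 0)"
  proof (rule tendsto_0_le[where K = C])
    show "((\<lambda>h::real. h) \<longlongrightarrow> 0) (at 0)" by simp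
    have "norm (flat \<delta> m h / h) \<le> norm h * C" for h
      using C[of h] flat_nonneg[of \<delta> m h]
      by (cases "h = 0") (simp_all add: divide_le_eq power2_eq_square mult_ac)
    then show "\<forall>\<^sub>F h in at 0. norm (flat \<delta> m h / h) \<le> norm h * C"
      by simp
  qed
  then have "(flat \<delta> m has_real_derivative 0) (at 0)"
    by (simp add: DERIV_def flat_def)
  then show ?thesis using equal by (simp add: flat_def)
next
  case greater
  have "((\<lambda>t. exp (- \<delta> / t) / t ^ m) has_real_derivative
      (exp (- \<delta> / t) * (\<delta> / t\<^sup>2) * t ^ m - exp (- \<delta> / t) * (m * t ^ (m - 1))) / (t ^ m)\<^sup>2) (at t)"
    using greater by (auto intro!: derivative_eq_intros simp: power2_eq_square)
  \<comment> \<open>The split on \<open>m\<close> is due to the truncated subtraction in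
    \<open>m - 1\<close>; for \<open>m = 0\<close> the factor \<open>m\<close> removes that
    term.\<close>
  also have "(exp (- \<delta> / t) * (\<delta> / t\<^sup>2) * t ^ m - exp (- \<delta> / t) * (m * t ^ (m - 1))) / (t ^ m)\<^sup>2
      = \<delta> * flat \<delta> (m + 2) t - m * flat \<delta> (m + 1) t"
    using greater by (cases m) (simp_all add: flat_def field_simps power2_eq_square)
  finally show ?thesis
    by (rule has_field_derivative_transform_within_open[of _ _ t "{0<..}"])
      (use greater in \<open>auto simp: flat_def\<close>)
qed

lemma C_k_flat_compose:
  assumes "\<delta> > 0" and "\<And>k. C_k k r"
  shows "C_k k (\<lambda>x. flat \<delta> m (r x))"
proof (induction k arbitrary: m)
  case 0
  have "continuous_on UNIV (flat \<delta> m)"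
    by (meson assms(1) flat_has_real_derivative DERIV_isCont continuous_at_imp_continuous_on)
  moreover have "continuous_on UNIV r" using assms(2)[of 0] by simp
  ultimately have "continuous_on UNIV (\<lambda>x. flat \<delta> m (r x))"
    by (metis continuous_on_compose2 subset_UNIV)
  then show ?case by simp
next
  case (Suc k)
  show ?case
  proof (rule C_k_SucI)
    fix x
    have "(r has_derivative frechet_derivative r (at x)) (at x)"
      using assms(2) C_k_Suc_has_derivative by blast
    from has_derivative_compose[OF this flat_has_real_derivative[OF assms(1), unfolded has_field_derivative_def]]
    show "((\<lambda>x. flat \<delta> m (r x)) has_derivative (\<lambda>v. (\<delta> * flat \<delta> (m + 2) (r x) + (- m) * flat \<delta> (m + 1) (r x))
       * frechet_derivative r (at x) v)) (at x)"
      by simp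
  next
    fix v
    have "C_k k (\<lambda>x. frechet_derivative r (at x) v)" using assms(2)[of "Suc k"] by simp
    then show "C_k k (\<lambda>x. (\<delta> * flat \<delta> (m + 2) (r x) + (- m) * flat \<delta> (m + 1) (r x))
       * frechet_derivative r (at x) v)"
      by (intro C_k_mult C_k_add C_k_cmult Suc.IH)
  qed
qed

text \<open>The argument varies together with \<open>\<delta>\<close> because the cutoffs below have
  the moving threshold \<open>1 - \<delta>\<close>.\<close>

lemma flat_0_tendsto:
  assumes "\<delta> \<longlonglongrightarrow> 0" "t \<longlonglongrightarrow> \<tau>" "\<tau> > 0"
  shows "(\<lambda>n. flat (\<delta> n) 0 (t n)) \<longlonglongrightarrow> 1"
proof (rule Lim_transform_eventually)
  have "(\<lambda>n. exp (- \<delta> n / t n)) \<longlonglongrightarrow> exp (- 0 / \<tau>)"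
    using assms by (intro tendsto_intros) auto
  then show "(\<lambda>n. exp (- \<delta> n / t n)) \<longlonglongrightarrow> 1" by simp
  show "\<forall>\<^sub>F n in sequentially. exp (- \<delta> n / t n) = flat (\<delta> n) 0 (t n)"
    using order_tendstoD(1)[OF assms(2,3)] by eventually_elim (simp add: flat_def)
qed

text \<open>This is the derivative of \<open>t * flat \<delta> 0 t\<close>, a smooth substitute for
  the positive part of \<open>t\<close>.\<close>

definition flat_slope :: "real \<Rightarrow> real \<Rightarrow> real" where
  "flat_slope \<delta> t = flat \<delta> 0 t + \<delta> * t * flat \<delta> 2 t"

lemma flat_slope_tendsto:
  assumes "\<delta> \<longlonglongrightarrow> 0" "t \<longlonglongrightarrow> \<tau>" "\<tau> > 0"
  shows "(\<lambda>n. flat_slope (\<delta> n) (t n)) \<longlonglongrightarrow> 1"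
proof -
  have "(\<lambda>n. \<delta> n * flat (\<delta> n) 0 (t n) / t n) \<longlonglongrightarrow> 0 * 1 / \<tau>"
    using assms by (intro tendsto_intros flat_0_tendsto) auto
  then have "(\<lambda>n. flat (\<delta> n) 0 (t n) + \<delta> n * flat (\<delta> n) 0 (t n) / t n) \<longlonglongrightarrow> 1 + 0 * 1 / \<tau>"
    by (intro tendsto_add flat_0_tendsto[OF assms])
  moreover have "flat_slope (\<delta> n) (t n) = flat (\<delta> n) 0 (t n) + \<delta> n * flat (\<delta> n) 0 (t n) / t n" for n
    by (simp add: flat_slope_def flat_def power2_eq_square)
  ultimately show ?thesis by simp
qed

text \<open>For \<open>t > 0\<close> and \<open>s = \<delta> / t\<close> the slope is
  \<open>(1 + s) * exp (- s)\<close>, and \<open>1 + s \<le> exp s\<close>. These bounds provide the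
  dominating function for the gradients of the approximations.\<close>

lemma flat_slope_bounds:
  assumes "\<delta> > 0"
  shows "0 \<le> flat_slope \<delta> t" "flat_slope \<delta> t \<le> 1"
proof -
  have eq: "flat_slope \<delta> t = (1 + \<delta> / t) * exp (- (\<delta> / t))" if "t > 0"
    using that by (simp add: flat_slope_def flat_def power2_eq_square distrib_right)
  have neg: "flat_slope \<delta> t = 0" if "\<not> t > 0"
    using that by (simp add: flat_slope_def flat_def)
  show "0 \<le> flat_slope \<delta> t"
    using assms by (cases "t > 0") (simp_all add: eq neg)
  have "(1 + \<delta> / t) * exp (- (\<delta> / t)) \<le> exp (\<delta> / t) * exp (- (\<delta> / t))"
    by (intro mult_right_mono exp_ge_add_one_self) simp
  then show "flat_slope \<delta> t \<le> 1"
    by (cases "t > 0") (simp_all add: eq neg flip: exp_add)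
qed

section \<open>Integrals of partial derivatives\<close>

lemma continuous_imp_measurable_lebesgue_on:
  fixes f :: "'a::euclidean_space \<Rightarrow> 'b::euclidean_space"
  assumes "continuous_on UNIV f"
  shows "f \<in> borel_measurable (lebesgue_on S)"
  using assms by (intro measurable_restrict_space1 measurable_completion) (simp add: borel_measurable_continuous_onI)

lemma integrable_lebesgue_on:
  fixes f :: "'a::euclidean_space \<Rightarrow> 'b::euclidean_space"
  assumes "integrable lebesgue f" "S \<in> sets lebesgue"
  shows "integrable (lebesgue_on S) f"
  using assms by (simp add: integrable_restrict_space integrable_mult_indicator)

lemma integrable_indicator_compact: "compact K \<Longrightarrow> integrable lebesgue (indicator K :: 'a::euclidean_space \<Rightarrow> real)"
  using lmeasurable_compact[of K] by (intro integrable_real_indicator) (auto simp: fmeasurable_def simp del: emeasure_completion)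

lemma integrable_continuous_compact_supp:
  fixes f :: "'a::euclidean_space \<Rightarrow> real"
  assumes "continuous_on UNIV f" "compact (supp f)"
  shows "integrable lebesgue f"
proof -
  have "bounded (f ` supp f)"
    using assms by (intro compact_imp_bounded compact_continuous_image) (auto intro: continuous_on_subset)
  then obtain B where B: "\<And>x. x \<in> supp f \<Longrightarrow> norm (f x) \<le> B" by (auto simp: bounded_iff)
  have "integrable lebesgue (\<lambda>x. indicator (supp f) x * B)"
    using integrable_indicator_compact[OF assms(2)] by simp
  then show ?thesis
  proof (rule Bochner_Integration.integrable_bound)
    show "f \<in> borel_measurable lebesgue"
      using continuous_imp_measurable_lebesgue_on[OF assms(1), of UNIV] by simp
    show "AE x in lebesgue. norm (f x) \<le> norm (indicator (supp f) x * B)"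
    proof (intro always_eventually allI)
      fix x show "norm (f x) \<le> norm (indicator (supp f) x * B)"
        using B[of x] eq_0_outside_supp[of x f] by (cases "x \<in> supp f") auto
    qed
  qed
qed

lemma lebesgue_integral_translate:
  fixes f :: "'a::euclidean_space \<Rightarrow> real"
  assumes "f \<in> borel_measurable borel"
  shows "(LINT x|lebesgue. f (x + c)) = (LINT x|lebesgue. f x)"
proof -
  have "(LINT x|lebesgue. f (x + c)) = (LINT x|lborel. f (c + x))"
    using assms by (simp add: integral_completion add.commute)
  also have "\<dots> = (LINT x|distr lborel borel ((+) c). f x)"
    using assms by (simp add: integral_distr)
  also have "\<dots> = (LINT x|lebesgue. f x)"
    using assms by (simp add: lborel_distr_plus integral_completion)
  finally show ?thesis .
qed

section \<open>Difference quotients of compactly supported functions\<close>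

lemma bounded_partial_derivative:
  fixes f :: "'a::euclidean_space \<Rightarrow> real"
  assumes "C_k 1 f" "compact (supp f)"
  obtains M where "\<And>x. \<bar>frechet_derivative f (at x) b\<bar> \<le> M"
proof -
  have "continuous_on UNIV (\<lambda>x. frechet_derivative f (at x) b)"
    using assms(1) by simp
  then have "bounded ((\<lambda>x. frechet_derivative f (at x) b) ` supp f)"
    by (intro compact_imp_bounded compact_continuous_image assms(2)) (auto intro: continuous_on_subset)
  then obtain B where B: "\<And>x. x \<in> supp f \<Longrightarrow> \<bar>frechet_derivative f (at x) b\<bar> \<le> B"
    by (auto simp: bounded_iff)
  have "\<bar>frechet_derivative f (at x) b\<bar> \<le> max B 0" for x
    using B[of x] frechet_derivative_eq_0_outside_supp[of x f] by (cases "x \<in> supp f") auto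
  then show ?thesis by (rule that)
qed

lemma has_real_derivative_along_line:
  fixes f :: "'a::euclidean_space \<Rightarrow> real"
  assumes "C_k 1 f"
  shows "((\<lambda>s. f (x + s *\<^sub>R b)) has_real_derivative frechet_derivative f (at (x + s *\<^sub>R b)) b) (at s)"
proof -
  let ?D = "frechet_derivative f (at (x + s *\<^sub>R b))"
  have *: "(f has_derivative ?D) (at (x + s *\<^sub>R b))"
    using assms by (intro C_k_Suc_has_derivative[of 0]) simp
  have "((\<lambda>s. x + s *\<^sub>R b) has_derivative (\<lambda>h. h *\<^sub>R b)) (at s)"
    by (auto intro!: derivative_eq_intros)
  from has_derivative_compose[OF this *]
  have "((\<lambda>s. f (x + s *\<^sub>R b)) has_derivative (\<lambda>h. ?D (h *\<^sub>R b))) (at s)" .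
  moreover have "?D (h *\<^sub>R b) = ?D b * h" for h
    using linear_scale[OF has_derivative_linear[OF *]] by simp
  ultimately show ?thesis by (simp add: has_field_derivative_def)
qed

text \<open>Dominated convergence. It is stated over an arbitrary measurable \<open>S\<close>
  because it serves twice: on the whole space for integration by parts, on the ellipsoid for the
  perimeter.\<close>

lemma difference_quotient_tendsto:
  fixes f :: "'a::euclidean_space \<Rightarrow> real"
  assumes f: "C_k 1 f" "compact (supp f)" and S: "S \<in> sets lebesgue"
  shows "(\<lambda>n. LINT x|lebesgue_on S. (f (x + inverse (Suc n) *\<^sub>R b) - f x) / inverse (Suc n))
    \<longlonglongrightarrow> (LINT x|lebesgue_on S. frechet_derivative f (at x) b)"
proof -
  obtain M where M: "\<And>x. \<bar>frechet_derivative f (at x) b\<bar> \<le> M"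
    using bounded_partial_derivative[OF f] by metis
  have cont: "continuous_on UNIV f" "continuous_on UNIV (\<lambda>x. frechet_derivative f (at x) b)"
    using C_k_continuous_on[OF f(1)] f(1) by auto
  \<comment> \<open>All steps \<open>inverse (Suc n)\<close> are at most 1, so every quotient
    vanishes off this one compact set; on it the mean value theorem bounds the quotient by
    \<open>M\<close>.\<close>
  define K where "K = {x + y | x y. x \<in> supp f \<and> y \<in> cball 0 (norm b)}"
  have K: "compact K" unfolding K_def by (intro compact_sums f(2) compact_cball)
  show ?thesis
  proof (rule integral_dominated_convergence[where w = "\<lambda>x. indicator K x * M"])
    show "(\<lambda>x. frechet_derivative f (at x) b) \<in> borel_measurable (lebesgue_on S)"
      by (intro continuous_imp_measurable_lebesgue_on cont)
    show "(\<lambda>x. (f (x + inverse (Suc n) *\<^sub>R b) - f x) / inverse (Suc n)) \<in> borel_measurable (lebesgue_on S)" for n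
      by (intro continuous_imp_measurable_lebesgue_on continuous_intros cont
          continuous_on_compose2[OF cont(1)]) auto
    show "integrable (lebesgue_on S) (\<lambda>x. indicator K x * M)"
      using integrable_indicator_compact[OF K] by (intro integrable_lebesgue_on S) simp
    show "AE x in lebesgue_on S. (\<lambda>n. (f (x + inverse (Suc n) *\<^sub>R b) - f x) / inverse (Suc n))
       \<longlonglongrightarrow> frechet_derivative f (at x) b"
    proof (intro always_eventually allI)
      fix x
      have "((\<lambda>s. f (x + s *\<^sub>R b)) has_real_derivative frechet_derivative f (at x) b) (at 0)"
        using has_real_derivative_along_line[OF f(1), of x b 0] by simp
      then have *: "((\<lambda>h. (f (x + h *\<^sub>R b) - f x) / h) \<longlongrightarrow> frechet_derivative f (at x) b) (at 0)"
        by (simp add: DERIV_def)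
      have "filterlim (\<lambda>n. inverse (real (Suc n))) (at 0) sequentially"
        using LIMSEQ_inverse_real_of_nat by (intro filterlim_atI) auto
      from filterlim_compose[OF * this]
      show "(\<lambda>n. (f (x + inverse (Suc n) *\<^sub>R b) - f x) / inverse (Suc n))
         \<longlonglongrightarrow> frechet_derivative f (at x) b" .
    qed
    show "AE x in lebesgue_on S. norm ((f (x + inverse (Suc n) *\<^sub>R b) - f x) / inverse (Suc n)) \<le> indicator K x * M" for n
    proof (intro always_eventually allI)
      fix x
      define t where "t = inverse (real (Suc n))"
      have t: "0 < t" "t \<le> 1" by (auto simp: t_def field_simps)
      have "norm ((f (x + t *\<^sub>R b) - f x) / t) \<le> indicator K x * M"
      proof (cases "x \<in> K")
        case True
        obtain s where "f (x + t *\<^sub>R b) - f (x + 0 *\<^sub>R b) = (t - 0) * frechet_derivative f (at (x + s *\<^sub>R b)) b"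
          using MVT2[OF t(1), of "\<lambda>s. f (x + s *\<^sub>R b)" "\<lambda>s. frechet_derivative f (at (x + s *\<^sub>R b)) b"]
            has_real_derivative_along_line[OF f(1)] by metis
        then show ?thesis using M True t by simp
      next
        case False
        have "x \<notin> supp f" using False unfolding K_def by (auto intro!: exI[of _ x] exI[of _ 0])
        moreover have "x + t *\<^sub>R b \<notin> supp f"
        proof
          assume *: "x + t *\<^sub>R b \<in> supp f"
          have "norm (- (t *\<^sub>R b)) \<le> norm b" using t by (simp add: mult_left_le_one_le)
          with * have "x \<in> K" unfolding K_def
            by (intro CollectI exI[of _ "x + t *\<^sub>R b"] exI[of _ "- (t *\<^sub>R b)"]) auto
          with False show False by simp
        qed
        ultimately show ?thesis by (simp add: False eq_0_outside_supp)
      qed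
      then show "norm ((f (x + inverse (Suc n) *\<^sub>R b) - f x) / inverse (Suc n)) \<le> indicator K x * M"
        by (simp add: t_def)
    qed
  qed
qed

lemma integrable_translate_compact_supp:
  fixes f :: "'a::euclidean_space \<Rightarrow> real"
  assumes "continuous_on UNIV f" "compact (supp f)"
  shows "integrable lebesgue (\<lambda>x. f (x + c))"
proof -
  have "integrable (distr lborel borel ((+) c)) f"
    using integrable_continuous_compact_supp[OF assms] assms(1)
    by (simp add: lborel_distr_plus integrable_completion borel_measurable_continuous_onI)
  then have "integrable lborel (\<lambda>x. f (c + x))"
    using assms(1) by (simp add: integrable_distr_eq borel_measurable_continuous_onI)
  then show ?thesis
    using assms(1) by (subst integrable_completion) (auto simp: add.commute intro!: borel_measurable_continuous_onI
        continuous_intros continuous_on_compose2[OF assms(1)])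
qed

text \<open>By translation invariance every difference quotient has integral 0, hence so does the
  limit.\<close>

lemma integral_partial_derivative_eq_0:
  fixes f :: "'a::euclidean_space \<Rightarrow> real"
  assumes f: "C_k 1 f" "compact (supp f)"
  shows "(LINT x|lebesgue. frechet_derivative f (at x) b) = 0"
proof -
  have cont: "continuous_on UNIV f" using f(1) C_k_continuous_on by blast
  have "(LINT x|lebesgue_on UNIV. (f (x + c) - f x) / t) = 0" for c t
    using integrable_translate_compact_supp[OF cont f(2)] integrable_continuous_compact_supp[OF cont f(2)]
      lebesgue_integral_translate[of f c] cont
    by (simp add: borel_measurable_continuous_onI lebesgue_on_UNIV_eq)
  with difference_quotient_tendsto[OF f, of UNIV b] show ?thesis
    unfolding lebesgue_on_UNIV_eq by (simp only: LIMSEQ_const_iff sets.top) simp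
qed

lemma integral_lebesgue_on_supp_subset:
  fixes f :: "'a::euclidean_space \<Rightarrow> real"
  assumes "S \<in> sets lebesgue" "\<And>x. x \<notin> S \<Longrightarrow> f x = 0"
  shows "(LINT x|lebesgue_on S. f x) = (LINT x|lebesgue. f x)"
  using assms by (simp add: integral_restrict_space)
    (intro Bochner_Integration.integral_cong, auto simp: indicator_def)

lemma supp_mult_subset: "supp (\<lambda>x. f x * g x :: real) \<subseteq> supp g"
  unfolding supp_def by (rule closure_mono) auto

lemma compact_supp_mult: "compact (supp g) \<Longrightarrow> compact (supp (\<lambda>x. f x * g x :: real))"
  by (rule compact_supp_subset[OF supp_mult_subset])

text \<open>The derivative of \<open>u * \<phi>\<close> integrates to 0 over the whole space, and
  the support of \<open>\<phi>\<close> lies in \<open>S\<close>, so that all integrals over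
  \<open>S\<close> are integrals over the whole space and no boundary term arises.\<close>

lemma integration_by_parts:
  fixes u \<phi> :: "'a::euclidean_space \<Rightarrow> real"
  assumes S: "open S" and u: "C_k 1 u" and \<phi>: "C_k 1 \<phi>" "compact (supp \<phi>)" "supp \<phi> \<subseteq> S"
  shows "(LINT x|lebesgue_on S. u x * frechet_derivative \<phi> (at x) b) =
    - (LINT x|lebesgue_on S. frechet_derivative u (at x) b * \<phi> x)"
proof -
  have D: "frechet_derivative (\<lambda>x. u x * \<phi> x) (at x) =
      (\<lambda>b. u x * frechet_derivative \<phi> (at x) b + frechet_derivative u (at x) b * \<phi> x)" for x
    using u \<phi>(1) by (intro frechet_derivative_at[symmetric] has_derivative_mult)
      (auto simp: frechet_derivative_works)
  have C: "continuous_on UNIV u" "continuous_on UNIV \<phi>" using C_k_continuous_on[OF u] C_k_continuous_on[OF \<phi>(1)] by auto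
  have supp': "supp (\<lambda>x. frechet_derivative \<phi> (at x) b) \<subseteq> supp \<phi>"
    using frechet_derivative_eq_0_outside_supp[of _ \<phi>]
    by (subst supp_def, intro closure_minimal) (auto simp: supp_def, metis)
  then have "compact (supp (\<lambda>x. frechet_derivative \<phi> (at x) b))"
    by (rule compact_supp_subset[OF _ \<phi>(2)])
  then have I1: "integrable lebesgue (\<lambda>x. u x * frechet_derivative \<phi> (at x) b)"
    using \<phi>(1) C by (intro integrable_continuous_compact_supp compact_supp_mult continuous_on_mult) auto
  have I2: "integrable lebesgue (\<lambda>x. frechet_derivative u (at x) b * \<phi> x)"
    using u C \<phi>(2) by (intro integrable_continuous_compact_supp compact_supp_mult continuous_on_mult) auto
  have S': "S \<in> sets lebesgue" using S by simp
  have "(LINT x|lebesgue_on S. u x * frechet_derivative \<phi> (at x) b) = (LINT x|lebesgue. u x * frechet_derivative \<phi> (at x) b)"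
    using \<phi>(3) frechet_derivative_eq_0_outside_supp[of _ \<phi>]
    by (intro integral_lebesgue_on_supp_subset S') (metis mult_zero_right subsetD)
  moreover have "(LINT x|lebesgue_on S. frechet_derivative u (at x) b * \<phi> x) = (LINT x|lebesgue. frechet_derivative u (at x) b * \<phi> x)"
    using \<phi>(3) eq_0_outside_supp[of _ \<phi>]
    by (intro integral_lebesgue_on_supp_subset S') auto
  moreover have "(LINT x|lebesgue. frechet_derivative (\<lambda>x. u x * \<phi> x) (at x) b) = 0"
    using u \<phi> by (intro integral_partial_derivative_eq_0 C_k_mult compact_supp_mult)
  ultimately show ?thesis using I1 I2 by (simp add: D)
qed

text \<open>Integrating difference quotients turns the integral of \<open>\<partial>\<^sub>b f\<close> into the volume between \<open>S\<close> and
  its translates by \<open>t b\<close>. Both lie in the dilation of \<open>S\<close> by \<open>1 + t s\<close>, and the derivative of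
  \<open>(1 + t s)\<^sup>d\<close> at \<open>t = 0\<close> yields the bound.\<close>

lemma integral_partial_derivative_le:
  fixes f :: "'a::euclidean_space \<Rightarrow> real"
  assumes f: "C_k 1 f" "compact (supp f)" and le: "AE x in lebesgue. \<bar>f x\<bar> \<le> 1"
    and S: "open S" "S \<in> lmeasurable" and s: "s \<ge> 0"
    and sub: "\<And>t x. t > 0 \<Longrightarrow> x \<in> S \<Longrightarrow> x \<in> (*\<^sub>R) (1 + t * s) ` S"
      "\<And>t x. t > 0 \<Longrightarrow> x \<in> S \<Longrightarrow> x + t *\<^sub>R b \<in> (*\<^sub>R) (1 + t * s) ` S"
  shows "(LINT x|lebesgue_on S. frechet_derivative f (at x) b) \<le> 2 * s * DIM('a) * measure lebesgue S"
proof (rule LIMSEQ_le[OF difference_quotient_tendsto[OF f]])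
  show S': "S \<in> sets lebesgue" using S by simp
  define m where "m = measure lebesgue S"
  \<comment> \<open>The dilation exceeds \<open>S\<close> in volume by
    \<open>m * ((1 + t * s) ^ DIM('a) - 1)\<close>. The factor 2 in \<open>2 * m * q t\<close>
    arises because \<open>S\<close> and its translate are each compared with the dilation.\<close>
  define q where "q = (\<lambda>t. ((1 + t * s) ^ DIM('a) - 1) / t)"
  have "((\<lambda>t. (1 + t * s) ^ DIM('a)) has_real_derivative DIM('a) * s) (at 0)"
    by (auto intro!: derivative_eq_intros)
  then have *: "(q \<longlongrightarrow> DIM('a) * s) (at 0)"
    by (simp add: DERIV_def q_def)
  have "filterlim (\<lambda>n. inverse (real (Suc n))) (at 0) sequentially"
    using LIMSEQ_inverse_real_of_nat by (intro filterlim_atI) auto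
  from tendsto_mult[OF tendsto_const[of "2 * m"] filterlim_compose[OF * this]]
  show "(\<lambda>n. 2 * m * q (inverse (real (Suc n)))) \<longlonglongrightarrow> 2 * s * DIM('a) * m"
    by (simp add: mult_ac)
  have cont: "continuous_on UNIV f" using f(1) C_k_continuous_on by blast
  have fm: "f \<in> borel_measurable borel" using cont by (rule borel_measurable_continuous_onI)
  have est: "(LINT x|lebesgue_on S. (f (x + t *\<^sub>R b) - f x) / t) \<le> 2 * m * q t" if t: "t > 0" for t
  proof -
    define S1 where "S1 = (+) (t *\<^sub>R b) ` S"
    define S2 where "S2 = (*\<^sub>R) (1 + t * s) ` S"
    have oS1: "open S1" unfolding S1_def using S(1) by (rule open_translation)
    have sub': "S \<subseteq> S2" "S1 \<subseteq> S2" using sub[OF t] by (auto simp: S1_def S2_def add.commute)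
    have S1: "S1 \<in> lmeasurable" "measure lebesgue S1 = m"
      unfolding S1_def m_def using S(2) by (auto simp: measurable_translation measure_translation)
    have ge: "1 + t * s > 0" using t s by (simp add: add_pos_nonneg)
    have S2: "measure lebesgue S2 = (1 + t * s) ^ DIM('a) * m"
      unfolding S2_def m_def using measure_lebesgue_affine[of "1 + t * s" 0 S] ge
      by (simp add: image_def)
    have S2': "S2 \<in> lmeasurable"
      using S ge emeasure_lebesgue_affine[of "1 + t * s" 0 S] unfolding S2_def
      by (intro fmeasurableI) (auto simp: open_scaling fmeasurable_def ennreal_mult_less_top ennreal_power)
    have i1: "integrable lebesgue (\<lambda>x. indicator S x * f (x + t *\<^sub>R b))"
      using integrable_mult_indicator[OF S' integrable_translate_compact_supp[OF cont f(2)]] by simp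
    have i0: "integrable lebesgue (\<lambda>x. indicator A x * f x)" if "open A" for A
      using integrable_mult_indicator[OF _ integrable_continuous_compact_supp[OF cont f(2)], of A] that by simp
    have "(LINT x|lebesgue. indicator S x * f (x + t *\<^sub>R b)) = (LINT x|lebesgue. indicator S1 (x + t *\<^sub>R b) * f (x + t *\<^sub>R b))"
      by (intro Bochner_Integration.integral_cong) (auto simp: S1_def indicator_def image_iff algebra_simps)
    also have "\<dots> = (LINT x|lebesgue. indicator S1 x * f x)"
      using oS1 fm by (intro lebesgue_integral_translate[where f = "\<lambda>x. indicator S1 x * f x"]) simp
    finally have "(LINT x|lebesgue. indicator S x * f (x + t *\<^sub>R b)) - (LINT x|lebesgue. indicator S x * f x)
       = (LINT x|lebesgue. indicator S1 x * f x - indicator S x * f x)"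
      using i0 oS1 S(1) by simp
    \<comment> \<open>Where exactly one of \<open>S1\<close> and \<open>S\<close> contains the
      point, the left side is at most 1 and, as both sets lie in \<open>S2\<close>, the right side
      equals 1. Elsewhere the left side is 0.\<close>
    also have "\<dots> \<le> (LINT x|lebesgue. (indicator S2 x - indicator S1 x) + (indicator S2 x - indicator S x))"
    proof (rule integral_mono_AE)
      show "integrable lebesgue (\<lambda>x. indicator S1 x * f x - indicator S x * f x)"
        using i0 oS1 S(1) by simp
      show "integrable lebesgue (\<lambda>x. (indicator S2 x - indicator S1 x) + (indicator S2 x - indicator S x) :: real)"
        using S1 S2' S by (intro Bochner_Integration.integrable_add Bochner_Integration.integrable_diff integrable_real_indicator)
          (auto simp: fmeasurable_def)
      show "AE x in lebesgue. indicator S1 x * f x - indicator S x * f x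
          \<le> (indicator S2 x - indicator S1 x) + (indicator S2 x - indicator S x)"
        using le by eventually_elim (use sub' in \<open>auto simp: indicator_def\<close>)
    qed
    also have "\<dots> = 2 * (measure lebesgue S2 - m)"
      using S1 S2' S by (subst Bochner_Integration.integral_add Bochner_Integration.integral_diff;
          (intro Bochner_Integration.integrable_diff integrable_real_indicator)?;
          simp add: fmeasurable_def m_def)+
    finally have "((LINT x|lebesgue. indicator S x * f (x + t *\<^sub>R b)) - (LINT x|lebesgue. indicator S x * f x)) / t
       \<le> 2 * (measure lebesgue S2 - m) / t" using t by (simp add: divide_right_mono)
    moreover have "(LINT x|lebesgue_on S. (f (x + t *\<^sub>R b) - f x) / t) =
      ((LINT x|lebesgue. indicator S x * f (x + t *\<^sub>R b)) - (LINT x|lebesgue. indicator S x * f x)) / t"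
      using i1 i0[OF S(1)] S' by (simp add: integral_restrict_space right_diff_distrib)
    moreover have "2 * (measure lebesgue S2 - m) / t = 2 * m * q t"
      by (simp add: S2 q_def right_diff_distrib mult_ac)
    ultimately show ?thesis by linarith
  qed
  show "\<exists>N. \<forall>n\<ge>N. (LINT x|lebesgue_on S. (f (x + inverse (Suc n) *\<^sub>R b) - f x) / inverse (Suc n))
      \<le> 2 * m * q (inverse (real (Suc n)))"
    by (intro exI allI impI est) simp
qed

section \<open>Square-integrable functions\<close>

lemma integrable_on_bounded:
  fixes f :: "'a::euclidean_space \<Rightarrow> 'b::euclidean_space"
  assumes "continuous_on UNIV f" "bounded S" "S \<in> lmeasurable"
  shows "integrable (lebesgue_on S) f"
proof -
  have "bounded (f ` closure S)"
    using assms by (intro compact_imp_bounded compact_continuous_image)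
      (auto intro: continuous_on_subset simp: compact_closure)
  then obtain B where "\<And>x. x \<in> closure S \<Longrightarrow> norm (f x) \<le> B" by (auto simp: bounded_iff)
  then have B: "\<And>x. x \<in> S \<Longrightarrow> norm (f x) \<le> B" using closure_subset by blast
  have "finite_measure (lebesgue_on S)"
    using assms(3) by (rule finite_measure_lebesgue_on)
  then show ?thesis
    by (rule finite_measure.integrable_const_bound[where B = B])
      (use B assms in \<open>auto simp: continuous_imp_measurable_lebesgue_on\<close>)
qed

lemma continuous_in_L2:
  fixes f :: "'a::euclidean_space \<Rightarrow> 'b::euclidean_space"
  assumes "continuous_on UNIV f" "bounded S" "S \<in> lmeasurable"
  shows "f \<in> L2 S"
  unfolding L2_def using assms
  by (auto intro!: continuous_imp_measurable_lebesgue_on integrable_on_bounded continuous_intros)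

lemma L2_diff:
  fixes f g :: "'a::euclidean_space \<Rightarrow> 'b::euclidean_space"
  assumes "f \<in> L2 S" "g \<in> L2 S"
  shows "(\<lambda>x. f x - g x) \<in> L2 S"
proof -
  have m: "(\<lambda>x. f x - g x) \<in> borel_measurable (lebesgue_on S)"
    using assms by (auto simp: L2_def)
  have "integrable (lebesgue_on S) (\<lambda>x. 2 * (norm (f x))\<^sup>2 + 2 * (norm (g x))\<^sup>2)"
    using assms by (auto simp: L2_def)
  then have "integrable (lebesgue_on S) (\<lambda>x. (norm (f x - g x))\<^sup>2)"
  proof (rule Bochner_Integration.integrable_bound)
    show "(\<lambda>x. (norm (f x - g x))\<^sup>2) \<in> borel_measurable (lebesgue_on S)"
      using m by measurable
    show "AE x in lebesgue_on S. norm ((norm (f x - g x))\<^sup>2) \<le> norm (2 * (norm (f x))\<^sup>2 + 2 * (norm (g x))\<^sup>2)"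
    proof (intro always_eventually allI)
      fix x
      have "(norm (f x - g x))\<^sup>2 \<le> (norm (f x) + norm (g x))\<^sup>2"
        by (intro power_mono norm_triangle_ineq4) simp
      also have "\<dots> \<le> 2 * (norm (f x))\<^sup>2 + 2 * (norm (g x))\<^sup>2"
        using sum_squares_bound[of "norm (f x)" "norm (g x)"] by (simp add: power2_sum)
      finally show "norm ((norm (f x - g x))\<^sup>2) \<le> norm (2 * (norm (f x))\<^sup>2 + 2 * (norm (g x))\<^sup>2)" by simp
    qed
  qed
  with m show ?thesis by (simp add: L2_def)
qed

text \<open>Young's inequality. Choosing the weight small against a fixed function takes the place
  of the Cauchy-Schwarz inequality for integrals.\<close>

lemma abs_inner_le_weighted:
  fixes x y :: "'a::real_inner"
  assumes "\<eta> > 0"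
  shows "\<bar>x \<bullet> y\<bar> \<le> \<eta> * (norm x)\<^sup>2 + (norm y)\<^sup>2 / \<eta>"
proof -
  have "\<bar>x \<bullet> y\<bar> \<le> norm x * norm y" by (rule Cauchy_Schwarz_ineq2)
  moreover have "2 * (sqrt \<eta> * norm x) * (norm y / sqrt \<eta>) \<le> (sqrt \<eta> * norm x)\<^sup>2 + (norm y / sqrt \<eta>)\<^sup>2"
    by (rule sum_squares_bound)
  then have "2 * (norm x * norm y) \<le> \<eta> * (norm x)\<^sup>2 + (norm y)\<^sup>2 / \<eta>"
    using assms by (simp add: power_mult_distrib power_divide)
  ultimately show ?thesis by (smt (verit) mult_nonneg_nonneg norm_ge_zero)
qed

lemma L2_inner_integrable:
  fixes f g :: "'a::euclidean_space \<Rightarrow> 'b::euclidean_space"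
  assumes "f \<in> L2 S" "g \<in> L2 S"
  shows "integrable (lebesgue_on S) (\<lambda>x. f x \<bullet> g x)"
proof (rule Bochner_Integration.integrable_bound)
  show "integrable (lebesgue_on S) (\<lambda>x. (norm (f x))\<^sup>2 + (norm (g x))\<^sup>2)"
    using assms by (auto simp: L2_def)
  show "(\<lambda>x. f x \<bullet> g x) \<in> borel_measurable (lebesgue_on S)"
    using assms by (auto simp: L2_def)
  show "AE x in lebesgue_on S. norm (f x \<bullet> g x) \<le> norm ((norm (f x))\<^sup>2 + (norm (g x))\<^sup>2)"
    using abs_inner_le_weighted[of 1 "f _" "g _"] by (intro always_eventually) simp
qed

lemma L2_integrable_of_lmeasurable:
  fixes f :: "'a::euclidean_space \<Rightarrow> real"
  assumes "f \<in> L2 S" "S \<in> lmeasurable"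
  shows "integrable (lebesgue_on S) f"
proof -
  have "(\<lambda>x. 1 :: real) \<in> L2 S"
    using finite_measure.integrable_const[OF finite_measure_lebesgue_on[OF assms(2)], of "1::real"]
    by (simp add: L2_def)
  from L2_inner_integrable[OF assms(1) this] show ?thesis by simp
qed

text \<open>Strong convergence to 0 implies weak convergence: the weight makes the contribution of
  \<open>f\<close> small uniformly in \<open>n\<close>, and the contribution of \<open>w n\<close>
  then becomes small for large \<open>n\<close>.\<close>

lemma L2_inner_tendsto_0:
  fixes f :: "'a::euclidean_space \<Rightarrow> 'b::euclidean_space"
  assumes f: "f \<in> L2 S" and w: "\<And>n. w n \<in> L2 S"
    and lim: "(\<lambda>n. LINT x|lebesgue_on S. (norm (w n x))\<^sup>2) \<longlonglongrightarrow> 0"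
  shows "(\<lambda>n. LINT x|lebesgue_on S. f x \<bullet> w n x) \<longlonglongrightarrow> 0"
proof (rule tendstoI)
  fix e :: real assume e: "e > 0"
  define A where "A = (LINT x|lebesgue_on S. (norm (f x))\<^sup>2)"
  have A: "A \<ge> 0" by (simp add: A_def)
  \<comment> \<open>With \<open>A + 1\<close> in place of \<open>A\<close> the quotient also makes
    sense for \<open>A = 0\<close>.\<close>
  define \<eta> where "\<eta> = e / (2 * (A + 1))"
  have \<eta>: "\<eta> > 0" using e A by (simp add: \<eta>_def)
  have "\<eta> * A < e / 2" using e A by (simp add: \<eta>_def field_simps)
  have "\<forall>\<^sub>F n in sequentially. (LINT x|lebesgue_on S. (norm (w n x))\<^sup>2) < e / 2 * \<eta>"
    using order_tendstoD(2)[OF lim, of "e / 2 * \<eta>"] e \<eta> by simp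
  then show "\<forall>\<^sub>F n in sequentially. dist (LINT x|lebesgue_on S. f x \<bullet> w n x) 0 < e"
  proof eventually_elim
    case (elim n)
    have "\<bar>LINT x|lebesgue_on S. f x \<bullet> w n x\<bar> \<le> (LINT x|lebesgue_on S. \<bar>f x \<bullet> w n x\<bar>)"
      by (rule integral_abs_bound)
    also have "\<dots> \<le> (LINT x|lebesgue_on S. \<eta> * (norm (f x))\<^sup>2 + (norm (w n x))\<^sup>2 / \<eta>)"
      using f w[of n] L2_inner_integrable[OF f w[of n]] abs_inner_le_weighted[OF \<eta>]
      by (intro integral_mono) (auto simp: L2_def)
    also have "\<dots> = \<eta> * A + (LINT x|lebesgue_on S. (norm (w n x))\<^sup>2) / \<eta>"
      using f w[of n] by (simp add: L2_def A_def)
    also have "\<dots> < e"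
      using \<open>\<eta> * A < e / 2\<close> elim \<eta> by (smt (verit) field_sum_of_halves pos_divide_less_eq)
    finally show ?case by simp
  qed
qed

text \<open>Testing the equations of two weak solutions against each other gives equal integrals.\<close>

lemma torsional_rigidity_eq:
  assumes "torsion_function S u"
  shows "torsional_rigidity S = (LINT x|lebesgue_on S. u x)"
proof -
  have "(LINT x|lebesgue_on S. u1 x) = (LINT x|lebesgue_on S. u2 x)"
    if "torsion_function S u1" "torsion_function S u2" for u1 u2
  proof -
    obtain g1 where g1: "has_weak_gradient S u1 g1"
      "\<And>v h. v \<in> H1_0 S \<Longrightarrow> has_weak_gradient S v h \<Longrightarrow>
           (LINT x|lebesgue_on S. g1 x \<bullet> h x) = (LINT x|lebesgue_on S. v x)"
      using \<open>torsion_function S u1\<close> unfolding torsion_function_def by blast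
    obtain g2 where g2: "has_weak_gradient S u2 g2"
      "\<And>v h. v \<in> H1_0 S \<Longrightarrow> has_weak_gradient S v h \<Longrightarrow>
           (LINT x|lebesgue_on S. g2 x \<bullet> h x) = (LINT x|lebesgue_on S. v x)"
      using \<open>torsion_function S u2\<close> unfolding torsion_function_def by blast
    show ?thesis
      using g1(2)[OF _ g2(1)] g2(2)[OF _ g1(1)] that by (simp add: torsion_function_def inner_commute)
  qed
  with assms show ?thesis unfolding torsional_rigidity_def by (intro the_equality) blast+
qed

section \<open>Ellipsoids\<close>

definition scaled :: "('a::euclidean_space \<Rightarrow> real) \<Rightarrow> 'a \<Rightarrow> 'a" where
  "scaled a x = (\<Sum>b\<in>Basis. (a b * (x \<bullet> b)) *\<^sub>R b)"

lemma scaled_inner: "b \<in> Basis \<Longrightarrow> scaled a x \<bullet> b = a b * (x \<bullet> b)"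
  by (simp add: scaled_def)

lemma linear_scaled: "linear (scaled a)"
  unfolding scaled_def
  by (rule linearI)
    (simp_all add: inner_left_distrib distrib_left scaleR_left_distrib sum.distrib scaleR_sum_right mult_ac)

definition quad :: "('a::euclidean_space \<Rightarrow> real) \<Rightarrow> 'a \<Rightarrow> real" where
  "quad a x = (\<Sum>b\<in>Basis. (x \<bullet> b / a b)\<^sup>2)"

definition ellipsoid :: "('a::euclidean_space \<Rightarrow> real) \<Rightarrow> 'a set" where
  "ellipsoid a = {x. quad a x < 1}"

lemma quad_nonneg: "quad a x \<ge> 0"
  by (simp add: quad_def sum_nonneg)

text \<open>Through this identity convexity, the triangle inequality and the volume of the ellipsoid
  are inherited from the Euclidean unit ball.\<close>

lemma quad_eq_norm: "quad a x = (norm (scaled (\<lambda>b. inverse (a b)) x))\<^sup>2"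
  unfolding power2_norm_eq_inner quad_def
  by (subst euclidean_inner, intro sum.cong refl) (simp add: scaled_inner power2_eq_square divide_inverse mult_ac)

lemma ellipsoid_eq_vimage: "ellipsoid a = scaled (\<lambda>b. inverse (a b)) -` ball 0 1"
  by (auto simp: ellipsoid_def quad_eq_norm power_less_one_iff abs_square_less_1)

lemma C_k_quad: "C_k k (quad a)"
  unfolding quad_def power2_eq_square divide_inverse
  by (intro C_k_sum C_k_mult C_k_linear C_k_const bounded_linear_inner_left finite_Basis)

lemma C_k_component: "C_k k (\<lambda>x. x \<bullet> b)"
  by (intro C_k_linear bounded_linear_inner_left)

lemma quad_has_derivative:
  "(quad a has_derivative (\<lambda>v. \<Sum>b\<in>Basis. 2 * (x \<bullet> b / a b) * (v \<bullet> b / a b))) (at x)"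
  unfolding quad_def
proof (rule has_derivative_sum)
  fix b
  have "((\<lambda>x. x \<bullet> b / a b) has_derivative (\<lambda>v. v \<bullet> b / a b)) (at x)"
    unfolding divide_inverse
    by (intro bounded_linear_imp_has_derivative bounded_linear_intros)
  from has_derivative_power[OF this, of 2]
  show "((\<lambda>x. (x \<bullet> b / a b)\<^sup>2) has_derivative (\<lambda>v. 2 * (x \<bullet> b / a b) * (v \<bullet> b / a b))) (at x)"
    by (simp add: mult_ac)
qed

lemma partial_derivative_quad:
  "b \<in> Basis \<Longrightarrow> frechet_derivative (quad a) (at x) b = 2 * (x \<bullet> b) / (a b)\<^sup>2"
  unfolding frechet_derivative_at[OF quad_has_derivative, symmetric]
  by (subst sum.remove[of _ b]) (auto simp: power2_eq_square inner_Basis intro!: sum.neutral split: if_splits)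

lemma quad_scaleR: "quad a (c *\<^sub>R x) = c\<^sup>2 * quad a x"
  by (simp add: quad_def sum_distrib_left power_mult_distrib power_divide)

lemma component_le_quad: "b \<in> Basis \<Longrightarrow> (x \<bullet> b / a b)\<^sup>2 \<le> quad a x"
  unfolding quad_def by (rule member_le_sum) auto

lemma sqrt_quad_triangle: "sqrt (quad a (x + y)) \<le> sqrt (quad a x) + sqrt (quad a y)"
  by (simp add: quad_eq_norm linear_add[OF linear_scaled] norm_triangle_ineq)

lemma compact_quad_le:
  assumes "\<And>b. b \<in> Basis \<Longrightarrow> a b > 0"
  shows "compact {x. quad a x \<le> R}"
proof -
  have "closed {x. quad a x \<le> R}"
    using C_k_continuous_on[OF C_k_quad[of 0 a]] by (intro closed_Collect_le) auto
  moreover have "bounded {x. quad a x \<le> R}"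
  proof (rule bounded_subset[OF bounded_cball])
    show "{x. quad a x \<le> R} \<subseteq> cball 0 (\<Sum>b\<in>Basis. a b * sqrt R)"
    proof
      fix x assume "x \<in> {x. quad a x \<le> R}"
      then have "\<bar>x \<bullet> b\<bar> \<le> a b * sqrt R" if "b \<in> Basis" for b
        using real_sqrt_le_mono[OF order_trans[OF component_le_quad[OF that, of x a]], of R] assms[OF that]
        by (simp add: abs_divide divide_le_eq mult_ac)
      then have "norm x \<le> (\<Sum>b\<in>Basis. a b * sqrt R)"
        by (intro order_trans[OF norm_le_l1] sum_mono)
      then show "x \<in> cball 0 (\<Sum>b\<in>Basis. a b * sqrt R)" by simp
    qed
  qed
  ultimately show ?thesis by (simp add: compact_eq_bounded_closed)
qed

lemma open_ellipsoid: "open (ellipsoid a)"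
  unfolding ellipsoid_def using C_k_continuous_on[OF C_k_quad[of 0 a]]
  by (intro open_Collect_less) auto

lemma convex_ellipsoid: "convex (ellipsoid a)"
  unfolding ellipsoid_eq_vimage by (intro convex_linear_vimage linear_scaled convex_ball)

lemma zero_in_ellipsoid: "0 \<in> ellipsoid a"
  by (simp add: ellipsoid_def quad_def)

lemma bounded_ellipsoid:
  assumes "\<And>b. b \<in> Basis \<Longrightarrow> a b > 0"
  shows "bounded (ellipsoid a)"
  using compact_imp_bounded[OF compact_quad_le[OF assms, where R = 1]]
  by (rule bounded_subset) (auto simp: ellipsoid_def)

lemma lmeasurable_ellipsoid:
  assumes "\<And>b. b \<in> Basis \<Longrightarrow> a b > 0"
  shows "ellipsoid a \<in> lmeasurable"
  by (intro lmeasurable_open bounded_ellipsoid open_ellipsoid assms)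

text \<open>The preimage of the ellipsoid under \<open>scaled a\<close> is the unit ball, and this
  diagonal map multiplies volume by the product of its entries.\<close>

lemma measure_ellipsoid:
  fixes a :: "'a::euclidean_space \<Rightarrow> real"
  assumes a: "\<And>b. b \<in> Basis \<Longrightarrow> a b > 0"
  shows "measure lebesgue (ellipsoid a) = (\<Prod>b\<in>Basis. a b) * measure lebesgue (ball 0 1 :: 'a set)"
proof -
  have E: "ellipsoid a \<in> sets borel" by (intro borel_open open_ellipsoid)
  have m: "scaled a \<in> borel_measurable borel"
    by (intro borel_measurable_continuous_onI linear_continuous_on linear_scaled
        linear_conv_bounded_linear[THEN iffD1])
  have "scaled (\<lambda>b. inverse (a b)) (scaled a x) = x" for x
  proof (rule euclidean_eqI)
    fix b :: 'a assume "b \<in> Basis"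
    with a[OF this] show "scaled (\<lambda>b. inverse (a b)) (scaled a x) \<bullet> b = x \<bullet> b"
      by (simp add: scaled_inner)
  qed
  then have vim: "scaled a -` ellipsoid a = ball 0 1"
    unfolding ellipsoid_eq_vimage by auto
  have "lborel = density (distr lborel borel (scaled a)) (\<lambda>_. (\<Prod>b\<in>Basis. \<bar>a b\<bar>))"
    by (rule trans[OF lborel_affine_euclidean[of a 0]]) (use a in \<open>force simp: scaled_def[abs_def]\<close>)+
  then have "emeasure lborel (ellipsoid a) =
      emeasure (density (distr lborel borel (scaled a)) (\<lambda>_. (\<Prod>b\<in>Basis. \<bar>a b\<bar>))) (ellipsoid a)"
    by (rule arg_cong)
  also have "\<dots> = (\<Prod>b\<in>Basis. \<bar>a b\<bar>) * emeasure lborel (ball 0 1 :: 'a set)"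
    using E m by (simp add: emeasure_density_const emeasure_distr vim)
  also have "(\<Prod>b\<in>Basis. \<bar>a b\<bar>) = (\<Prod>b\<in>Basis. a b)"
    using a by (intro prod.cong) (auto simp: less_imp_le)
  finally show ?thesis
    using a E by (simp add: measure_def enn2real_mult prod_nonneg less_imp_le)
qed

section \<open>Torsion of ellipsoids\<close>

locale ellipsoid_axes =
  fixes a :: "'a::euclidean_space \<Rightarrow> real"
  assumes axes_pos: "\<And>b. b \<in> Basis \<Longrightarrow> a b > 0"
begin

text \<open>Smooth, at most 1 for \<open>\<delta> > 0\<close>, and zero where
  \<open>quad a x \<ge> R\<close>. Two choices occur: \<open>R = 1 - \<delta>\<close> with
  \<open>\<delta>\<close> tending to 0 for test functions inside the ellipsoid, and
  \<open>R = 2\<close> with \<open>\<delta> = 1/4\<close> for a vector field that must not vanish at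
  its boundary.\<close>

definition cutoff :: "real \<Rightarrow> real \<Rightarrow> 'a \<Rightarrow> real" where
  "cutoff \<delta> R x = flat \<delta> 0 (R - quad a x)"

lemma C_k_const_minus_quad: "C_k k (\<lambda>x. c - quad a x)"
  using C_k_add[OF C_k_const[of k c] C_k_cmult[OF C_k_quad[of k a], of "-1"]] by simp

lemma C_k_cutoff: "\<delta> > 0 \<Longrightarrow> C_k k (cutoff \<delta> R)"
  unfolding cutoff_def[abs_def] by (intro C_k_flat_compose C_k_const_minus_quad)

lemma supp_cutoff: "supp (\<lambda>x. w x * cutoff \<delta> R x) \<subseteq> {x. quad a x \<le> R}"
  unfolding supp_def
proof (rule closure_minimal)
  show "{x. w x * cutoff \<delta> R x \<noteq> 0} \<subseteq> {x. quad a x \<le> R}"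
    by (auto simp: cutoff_def flat_def split: if_splits)
  show "closed {x. quad a x \<le> R}"
    by (intro compact_imp_closed compact_quad_le axes_pos)
qed

lemma compact_supp_cutoff: "compact (supp (\<lambda>x. w x * cutoff \<delta> R x))"
  by (rule compact_supp_subset[OF supp_cutoff compact_quad_le[OF axes_pos]])

text \<open>The threshold is strictly below 1 because the support is only known to lie in the closed
  set \<open>quad a x \<le> R\<close>, which has to fit into the open ellipsoid.\<close>

lemma mult_cutoff_in_test_functions:
  assumes "\<And>k. C_k k w" "\<delta> > 0"
  shows "(\<lambda>x. w x * cutoff \<delta> (1 - \<delta>) x) \<in> test_functions (ellipsoid a)"
  using supp_cutoff[of w \<delta> "1 - \<delta>"] compact_supp_cutoff[of w \<delta> "1 - \<delta>"] assms
  by (auto simp: test_functions_def ellipsoid_def intro!: C_k_mult C_k_cutoff)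

text \<open>Half the Laplacian of \<open>quad a\<close>. Division of \<open>1 - quad a x\<close> by
  \<open>2 * trace_inv\<close> therefore gives a solution of \<open>-\<Delta>u = 1\<close> that
  vanishes where \<open>quad a x = 1\<close>.\<close>

definition trace_inv :: real where
  "trace_inv = (\<Sum>b\<in>Basis. 1 / (a b)\<^sup>2)"

lemma trace_inv_pos: "trace_inv > 0"
  unfolding trace_inv_def using axes_pos by (intro sum_pos) (auto simp: zero_less_power less_imp_neq[symmetric])

definition torsion :: "'a \<Rightarrow> real" where
  "torsion x = (1 - quad a x) / (2 * trace_inv)"

lemma C_k_torsion: "C_k k torsion"
  using C_k_cmult[OF C_k_const_minus_quad[of k 1], of "1 / (2 * trace_inv)"]
  by (simp add: torsion_def[abs_def])

lemma quad_has_frechet_derivative: "(quad a has_derivative frechet_derivative (quad a) (at x)) (at x)"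
  by (rule C_k_Suc_has_derivative[OF C_k_quad])

lemma partial_derivative_torsion:
  assumes "b \<in> Basis"
  shows "frechet_derivative torsion (at x) b = - (1 / ((a b)\<^sup>2 * trace_inv)) * (x \<bullet> b)"
proof -
  have "(torsion has_derivative (\<lambda>v. (0 - frechet_derivative (quad a) (at x) v) / (2 * trace_inv))) (at x)"
    unfolding torsion_def[abs_def] divide_inverse
    by (intro has_derivative_mult_left has_derivative_diff has_derivative_const quad_has_frechet_derivative)
  from frechet_derivative_at[OF this, symmetric] show ?thesis
    by (simp add: partial_derivative_quad[OF assms] mult_ac)
qed

abbreviation "E \<equiv> ellipsoid a"

lemma E_sets: "E \<in> sets lebesgue"
  by (simp add: borel_open open_ellipsoid)

lemma E_lmeasurable: "E \<in> lmeasurable"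
  by (intro lmeasurable_ellipsoid axes_pos)

lemma E_bounded: "bounded E"
  by (intro bounded_ellipsoid axes_pos)

lemma integration_by_parts_E:
  assumes "C_k 1 f" "\<phi> \<in> test_functions E"
  shows "(LINT x|lebesgue_on E. f x * frechet_derivative \<phi> (at x) b) =
    - (LINT x|lebesgue_on E. frechet_derivative f (at x) b * \<phi> x)"
  using assms unfolding test_functions_def
  by (intro integration_by_parts open_ellipsoid) auto

lemma test_function_L2: "\<phi> \<in> test_functions E \<Longrightarrow> \<phi> \<in> L2 E"
  by (intro continuous_in_L2 E_bounded E_lmeasurable C_k_continuous_on[of 0] test_functions_C_k)

lemma gradient_L2: "C_k 1 f \<Longrightarrow> gradient f \<in> L2 E"
  by (intro continuous_in_L2 E_bounded E_lmeasurable continuous_gradient)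

lemma torsion_has_weak_gradient: "has_weak_gradient E torsion (gradient torsion)"
  unfolding has_weak_gradient_def
proof (intro conjI ballI)
  show "torsion \<in> L2 E"
    by (intro continuous_in_L2 E_bounded E_lmeasurable C_k_continuous_on[of 0] C_k_torsion)
  show "gradient torsion \<in> L2 E"
    by (intro gradient_L2 C_k_torsion)
next
  fix \<phi> and b :: 'a assume "\<phi> \<in> test_functions E" "b \<in> Basis"
  then show "(LINT x|lebesgue_on E. torsion x * frechet_derivative \<phi> (at x) b) =
      - (LINT x|lebesgue_on E. gradient torsion x \<bullet> b * \<phi> x)"
    using integration_by_parts_E[OF C_k_torsion] by (simp add: gradient_inner)
qed

text \<open>The same \<open>1 - \<delta>\<close> stands in the polynomial factor and in the cutoff,
  so that with \<open>t = 1 - \<delta> - quad a x\<close> this is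
  \<open>t * flat \<delta> 0 t\<close> up to a constant. Its gradient is then a multiple, by a
  factor between 0 and 1, of the gradient of \<open>torsion\<close>, and no separate term from the
  cutoff has to be controlled near the boundary.\<close>

definition torsion_approx :: "real \<Rightarrow> 'a \<Rightarrow> real" where
  "torsion_approx \<delta> x = (1 - \<delta> - quad a x) / (2 * trace_inv) * cutoff \<delta> (1 - \<delta>) x"

lemma torsion_approx_test_function:
  assumes "\<delta> > 0"
  shows "torsion_approx \<delta> \<in> test_functions E"
proof -
  have "C_k k (\<lambda>x. 1 / (2 * trace_inv) * (1 - \<delta> - quad a x))" for k
    by (intro C_k_cmult C_k_const_minus_quad)
  from mult_cutoff_in_test_functions[OF this assms] show ?thesis
    by (simp add: torsion_approx_def[abs_def])
qed

lemma gradient_torsion_approx: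
  assumes "\<delta> > 0"
  shows "gradient (torsion_approx \<delta>) x = flat_slope \<delta> (1 - \<delta> - quad a x) *\<^sub>R gradient torsion x"
proof -
  define t where "t = 1 - \<delta> - quad a x"
  let ?D = "frechet_derivative (quad a) (at x)"
  have 1: "((\<lambda>x. 1 - \<delta> - quad a x) has_derivative (\<lambda>v. - ?D v)) (at x)"
    using has_derivative_diff[OF has_derivative_const quad_has_frechet_derivative, of "1 - \<delta>"] by simp
  have "((\<lambda>t. t / (2 * trace_inv) * flat \<delta> 0 t) has_real_derivative
      flat_slope \<delta> t / (2 * trace_inv)) (at t)"
    using trace_inv_pos
    by (auto intro!: derivative_eq_intros flat_has_real_derivative[OF assms]
        simp: flat_slope_def add_divide_distrib numeral_2_eq_2)
  from has_derivative_compose[OF 1 this[unfolded has_field_derivative_def t_def]]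
  have "(torsion_approx \<delta> has_derivative (\<lambda>v. flat_slope \<delta> t / (2 * trace_inv) * - ?D v)) (at x)"
    by (simp add: torsion_approx_def[abs_def] cutoff_def t_def)
  from frechet_derivative_at[OF this, symmetric] show ?thesis
    unfolding gradient_def scaleR_sum_right t_def[symmetric]
    by (intro sum.cong refl) (simp add: partial_derivative_torsion partial_derivative_quad mult_ac)
qed

text \<open>Both parts of the \<open>H1\<close> error vanish by dominated convergence. On
  \<open>E\<close> the approximation lies between 0 and \<open>torsion\<close>, and the error of the
  gradient is \<open>flat_slope - 1\<close> times the gradient of \<open>torsion\<close>; the
  squares of \<open>torsion\<close> and of its gradient dominate.\<close>

lemma torsion_H1_0: "torsion \<in> H1_0 E"
proof -
  define \<delta> where "\<delta> = (\<lambda>n. inverse (real (Suc n)))"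
  have \<delta>: "\<delta> n > 0" for n by (simp add: \<delta>_def)
  have lim: "\<delta> \<longlonglongrightarrow> 0" unfolding \<delta>_def by (rule LIMSEQ_inverse_real_of_nat)
  have limt: "(\<lambda>n. 1 - \<delta> n - quad a x) \<longlonglongrightarrow> 1 - quad a x" for x
    using tendsto_diff[OF tendsto_diff[OF tendsto_const[of 1] lim] tendsto_const[of "quad a x"]] by simp
  have cu: "continuous_on UNIV torsion" by (intro C_k_continuous_on[of 0] C_k_torsion)
  have cg: "continuous_on UNIV (gradient torsion)" by (intro continuous_gradient C_k_torsion)
  have cf: "C_k k (torsion_approx (\<delta> n))" for k n
    using torsion_approx_test_function[OF \<delta>] by (rule test_functions_C_k)
  have A: "(\<lambda>n. LINT x|lebesgue_on E. (torsion_approx (\<delta> n) x - torsion x)\<^sup>2) \<longlonglongrightarrow> (LINT x|lebesgue_on E. 0)"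
  proof (rule integral_dominated_convergence[where w = "\<lambda>x. (torsion x)\<^sup>2"])
    show "integrable (lebesgue_on E) (\<lambda>x. (torsion x)\<^sup>2)"
      by (intro integrable_on_bounded E_bounded E_lmeasurable continuous_intros cu)
    show "(\<lambda>x. (torsion_approx (\<delta> n) x - torsion x)\<^sup>2) \<in> borel_measurable (lebesgue_on E)" for n
      by (intro continuous_imp_measurable_lebesgue_on continuous_intros cu C_k_continuous_on[of 0] cf)
    show "AE x in lebesgue_on E. (\<lambda>n. (torsion_approx (\<delta> n) x - torsion x)\<^sup>2) \<longlonglongrightarrow> 0"
    proof (rule AE_I2)
      fix x assume "x \<in> space (lebesgue_on E)"
      then have "1 - quad a x > 0" by (simp add: ellipsoid_def)
      then have "(\<lambda>n. (1 - \<delta> n - quad a x) / (2 * trace_inv) * flat (\<delta> n) 0 (1 - \<delta> n - quad a x))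
          \<longlonglongrightarrow> (1 - quad a x) / (2 * trace_inv) * 1"
        using trace_inv_pos by (intro tendsto_mult tendsto_divide limt tendsto_const flat_0_tendsto[OF lim limt]) auto
      then have "(\<lambda>n. torsion_approx (\<delta> n) x) \<longlonglongrightarrow> torsion x"
        by (simp add: torsion_approx_def cutoff_def torsion_def)
      from tendsto_power[OF tendsto_diff[OF this tendsto_const[of "torsion x"]], of 2]
      show "(\<lambda>n. (torsion_approx (\<delta> n) x - torsion x)\<^sup>2) \<longlonglongrightarrow> 0" by simp
    qed
    show "AE x in lebesgue_on E. norm ((torsion_approx (\<delta> n) x - torsion x)\<^sup>2) \<le> (torsion x)\<^sup>2" for n
    proof (rule AE_I2)
      fix x assume "x \<in> space (lebesgue_on E)"
      then have "1 - quad a x > 0" by (simp add: ellipsoid_def)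
      have "0 \<le> torsion_approx (\<delta> n) x"
        using trace_inv_pos by (simp add: torsion_approx_def cutoff_def flat_def)
      moreover have "torsion_approx (\<delta> n) x \<le> torsion x"
      proof (cases "1 - \<delta> n - quad a x > 0")
        case True
        then have "torsion_approx (\<delta> n) x \<le> (1 - \<delta> n - quad a x) / (2 * trace_inv) * 1"
          unfolding torsion_approx_def cutoff_def using trace_inv_pos
          by (intro mult_left_mono flat_0_le_1 \<delta>) auto
        also have "\<dots> \<le> torsion x"
          unfolding torsion_def using trace_inv_pos less_imp_le[OF \<delta>[of n]] by (simp add: divide_right_mono)
        finally show ?thesis .
      next
        case False
        then show ?thesis using \<open>1 - quad a x > 0\<close> trace_inv_pos
          by (simp add: torsion_approx_def cutoff_def flat_def torsion_def)
      qed
      ultimately have "\<bar>torsion_approx (\<delta> n) x - torsion x\<bar> \<le> \<bar>torsion x\<bar>" by linarith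
      then show "norm ((torsion_approx (\<delta> n) x - torsion x)\<^sup>2) \<le> (torsion x)\<^sup>2"
        by (simp add: abs_le_square_iff)
    qed
  qed simp
  have B: "(\<lambda>n. LINT x|lebesgue_on E. (norm (gradient (torsion_approx (\<delta> n)) x - gradient torsion x))\<^sup>2)
      \<longlonglongrightarrow> (LINT x|lebesgue_on E. 0)"
  proof (rule integral_dominated_convergence[where w = "\<lambda>x. (norm (gradient torsion x))\<^sup>2"])
    show "integrable (lebesgue_on E) (\<lambda>x. (norm (gradient torsion x))\<^sup>2)"
      by (intro integrable_on_bounded E_bounded E_lmeasurable continuous_intros cg)
    show "(\<lambda>x. (norm (gradient (torsion_approx (\<delta> n)) x - gradient torsion x))\<^sup>2) \<in> borel_measurable (lebesgue_on E)" for n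
      by (intro continuous_imp_measurable_lebesgue_on continuous_intros cg continuous_gradient cf)
    have eq: "gradient (torsion_approx (\<delta> n)) x - gradient torsion x
      = (flat_slope (\<delta> n) (1 - \<delta> n - quad a x) - 1) *\<^sub>R gradient torsion x" for n x
      by (simp add: gradient_torsion_approx[OF \<delta>] scaleR_left_diff_distrib)
    show "AE x in lebesgue_on E. (\<lambda>n. (norm (gradient (torsion_approx (\<delta> n)) x - gradient torsion x))\<^sup>2) \<longlonglongrightarrow> 0"
    proof (rule AE_I2)
      fix x assume "x \<in> space (lebesgue_on E)"
      then have "1 - quad a x > 0" by (simp add: ellipsoid_def)
      from flat_slope_tendsto[OF lim limt this]
      have "(\<lambda>n. (norm ((flat_slope (\<delta> n) (1 - \<delta> n - quad a x) - 1) *\<^sub>R gradient torsion x))\<^sup>2)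
        \<longlonglongrightarrow> (norm ((1 - 1) *\<^sub>R gradient torsion x))\<^sup>2"
        by (intro tendsto_intros)
      then show "(\<lambda>n. (norm (gradient (torsion_approx (\<delta> n)) x - gradient torsion x))\<^sup>2) \<longlonglongrightarrow> 0"
        unfolding eq by simp
    qed
    show "AE x in lebesgue_on E. norm ((norm (gradient (torsion_approx (\<delta> n)) x - gradient torsion x))\<^sup>2)
       \<le> (norm (gradient torsion x))\<^sup>2" for n
    proof (intro always_eventually allI)
      fix x
      have "\<bar>flat_slope (\<delta> n) (1 - \<delta> n - quad a x) - 1\<bar> * norm (gradient torsion x) \<le> 1 * norm (gradient torsion x)"
        using flat_slope_bounds[OF \<delta>[of n], of "1 - \<delta> n - quad a x"] by (intro mult_right_mono) auto
      then show "norm ((norm (gradient (torsion_approx (\<delta> n)) x - gradient torsion x))\<^sup>2)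
       \<le> (norm (gradient torsion x))\<^sup>2"
        unfolding eq by (simp add: power_mono)
    qed
  qed simp
  show ?thesis
    unfolding H1_0_def using torsion_has_weak_gradient tendsto_add[OF A B] torsion_approx_test_function[OF \<delta>]
    by (intro CollectI exI[of _ "gradient torsion"] conjI exI[of _ "\<lambda>n. torsion_approx (\<delta> n)"]) auto
qed

text \<open>The weak form of \<open>-\<Delta>u = 1\<close>. Component \<open>b\<close> of the
  gradient is the linear function \<open>c b * (x \<bullet> b)\<close>, so integration by parts
  leaves the constants \<open>- c b\<close>, whose sum is 1 by the choice of
  \<open>trace_inv\<close>.\<close>

lemma integral_gradient_torsion_test:
  assumes "\<phi> \<in> test_functions E"
  shows "(LINT x|lebesgue_on E. gradient torsion x \<bullet> gradient \<phi> x) = (LINT x|lebesgue_on E. \<phi> x)"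
proof -
  define c where "c b = - (1 / ((a b)\<^sup>2 * trace_inv))" for b
  note \<phi> = test_functions_C_k[OF assms]
  have cl: "C_k k (\<lambda>x. c b * (x \<bullet> b))" for k b by (intro C_k_cmult C_k_component)
  have D: "frechet_derivative (\<lambda>x. c b * (x \<bullet> b)) (at x) b = c b" if "b \<in> Basis" for b x
  proof -
    have "((\<lambda>x. c b * (x \<bullet> b)) has_derivative (\<lambda>v. c b * (v \<bullet> b))) (at x)"
      by (intro has_derivative_mult_right bounded_linear_imp_has_derivative bounded_linear_inner_left)
    from frechet_derivative_at[OF this, symmetric] show ?thesis using that by simp
  qed
  have int: "integrable (lebesgue_on E) (\<lambda>x. c b * (x \<bullet> b) * frechet_derivative \<phi> (at x) b)" for b
    using \<phi>[of 1]
    by (intro integrable_on_bounded E_bounded E_lmeasurable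
        continuous_on_mult[OF C_k_continuous_on[OF cl[of 0 b]]]) auto
  have "gradient torsion x \<bullet> gradient \<phi> x = (\<Sum>b\<in>Basis. c b * (x \<bullet> b) * frechet_derivative \<phi> (at x) b)" for x
    by (subst euclidean_inner) (simp add: gradient_inner partial_derivative_torsion c_def)
  then have "(LINT x|lebesgue_on E. gradient torsion x \<bullet> gradient \<phi> x)
      = (\<Sum>b\<in>Basis. LINT x|lebesgue_on E. c b * (x \<bullet> b) * frechet_derivative \<phi> (at x) b)"
    using int by (simp add: Bochner_Integration.integral_sum)
  also have "\<dots> = (\<Sum>b\<in>Basis. - (LINT x|lebesgue_on E. c b * \<phi> x))"
    by (intro sum.cong refl) (simp only: integration_by_parts_E[OF cl assms] D)
  also have "\<dots> = (\<Sum>b\<in>Basis. - c b) * (LINT x|lebesgue_on E. \<phi> x)"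
    by (simp add: sum_distrib_right sum_negf)
  also have "(\<Sum>b\<in>Basis. - c b) = (\<Sum>b\<in>Basis. 1 / (a b)\<^sup>2) / trace_inv"
    unfolding sum_divide_distrib c_def by simp
  also have "\<dots> = 1" using trace_inv_pos by (simp add: trace_inv_def[symmetric])
  finally show ?thesis by simp
qed

text \<open>A weak gradient is determined only up to null sets; testing against \<open>(x \<bullet> b)\<close> times a cutoff
  is all of the uniqueness that is needed here.\<close>

lemma integral_gradient_torsion_unique:
  assumes "has_weak_gradient E v g" "has_weak_gradient E v h"
  shows "(LINT x|lebesgue_on E. gradient torsion x \<bullet> g x) = (LINT x|lebesgue_on E. gradient torsion x \<bullet> h x)"
proof -
  define \<delta> where "\<delta> = (\<lambda>n. inverse (real (Suc n)))"
  have \<delta>: "\<delta> n > 0" for n by (simp add: \<delta>_def)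
  have lim: "\<delta> \<longlonglongrightarrow> 0" unfolding \<delta>_def by (rule LIMSEQ_inverse_real_of_nat)
  have limt: "(\<lambda>n. 1 - \<delta> n - quad a x) \<longlonglongrightarrow> 1 - quad a x" for x
    using tendsto_diff[OF tendsto_diff[OF tendsto_const[of 1] lim] tendsto_const[of "quad a x"]] by simp
  have gh: "g \<in> L2 E" "h \<in> L2 E" using assms by (auto simp: has_weak_gradient_def)
  have "gradient torsion \<in> L2 E" by (intro gradient_L2 C_k_torsion)
  note int_gh = L2_inner_integrable[OF this L2_diff[OF gh]]
  have comp: "(LINT x|lebesgue_on E. (gradient torsion x \<bullet> b) * ((g x - h x) \<bullet> b)) = 0"
    and int_comp: "integrable (lebesgue_on E) (\<lambda>x. (gradient torsion x \<bullet> b) * ((g x - h x) \<bullet> b))"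
    if b: "b \<in> Basis" for b
  proof -
    define l where "l x = gradient torsion x \<bullet> b" for x
    have l: "l = (\<lambda>x. - (1 / ((a b)\<^sup>2 * trace_inv)) * (x \<bullet> b))"
      by (simp add: l_def[abs_def] gradient_inner[OF b] partial_derivative_torsion[OF b])
    have lC: "C_k k l" for k unfolding l by (intro C_k_cmult C_k_component)
    have comp_L2: "(\<lambda>x. f x \<bullet> b) \<in> L2 E" if "f \<in> L2 E" for f :: "'a \<Rightarrow> 'a"
    proof -
      have "integrable (lebesgue_on E) (\<lambda>x. (norm (f x \<bullet> b))\<^sup>2)"
      proof (rule Bochner_Integration.integrable_bound)
        show "integrable (lebesgue_on E) (\<lambda>x. (norm (f x))\<^sup>2)" using that by (simp add: L2_def)
        show "(\<lambda>x. (norm (f x \<bullet> b))\<^sup>2) \<in> borel_measurable (lebesgue_on E)"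
          using that by (auto simp: L2_def)
        show "AE x in lebesgue_on E. norm ((norm (f x \<bullet> b))\<^sup>2) \<le> norm ((norm (f x))\<^sup>2)"
          using Basis_le_norm[OF b] by (intro always_eventually) (simp add: abs_le_square_iff[symmetric])
      qed
      with that show ?thesis by (auto simp: L2_def)
    qed
    have lL2: "l \<in> L2 E" by (intro continuous_in_L2 E_bounded E_lmeasurable C_k_continuous_on[of 0] lC)
    have int: "integrable (lebesgue_on E) (\<lambda>x. l x * ((g x - h x) \<bullet> b))"
      using L2_inner_integrable[OF lL2 comp_L2[OF L2_diff[OF gh]]] by simp
    then show "integrable (lebesgue_on E) (\<lambda>x. (gradient torsion x \<bullet> b) * ((g x - h x) \<bullet> b))"
      by (simp add: l_def)
    \<comment> \<open>Both weak gradients are tested on the same function. The left sides of the two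
      defining identities involve only \<open>v\<close> and coincide.\<close>
    have zero: "(LINT x|lebesgue_on E. l x * cutoff (\<delta> n) (1 - \<delta> n) x * ((g x - h x) \<bullet> b)) = 0" for n
    proof -
      define \<phi> where "\<phi> = (\<lambda>x. l x * cutoff (\<delta> n) (1 - \<delta> n) x)"
      have \<phi>: "\<phi> \<in> test_functions E" unfolding \<phi>_def by (intro mult_cutoff_in_test_functions lC \<delta>)
      have "integrable (lebesgue_on E) (\<lambda>x. g x \<bullet> b * \<phi> x)" "integrable (lebesgue_on E) (\<lambda>x. h x \<bullet> b * \<phi> x)"
        using L2_inner_integrable[OF comp_L2 test_function_L2[OF \<phi>]] gh by auto
      moreover have "(LINT x|lebesgue_on E. g x \<bullet> b * \<phi> x) = (LINT x|lebesgue_on E. h x \<bullet> b * \<phi> x)"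
      proof -
        have "(LINT x|lebesgue_on E. v x * frechet_derivative \<phi> (at x) b) = - (LINT x|lebesgue_on E. f x \<bullet> b * \<phi> x)"
          if "has_weak_gradient E v f" for f
          using that \<phi> b by (simp add: has_weak_gradient_def)
        from this[OF assms(1)] this[OF assms(2)] show ?thesis by simp
      qed
      ultimately have "(LINT x|lebesgue_on E. g x \<bullet> b * \<phi> x - h x \<bullet> b * \<phi> x) = 0" by simp
      then show ?thesis by (simp add: \<phi>_def inner_diff_left algebra_simps)
    qed
    \<comment> \<open>The cutoffs lie between 0 and 1 and tend to 1 on \<open>E\<close>, so the
      absolute value of the limit integrand dominates.\<close>
    have "(\<lambda>n. LINT x|lebesgue_on E. l x * cutoff (\<delta> n) (1 - \<delta> n) x * ((g x - h x) \<bullet> b))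
      \<longlonglongrightarrow> (LINT x|lebesgue_on E. l x * ((g x - h x) \<bullet> b))"
    proof (rule integral_dominated_convergence[where w = "\<lambda>x. \<bar>l x * ((g x - h x) \<bullet> b)\<bar>"])
      show "(\<lambda>x. l x * ((g x - h x) \<bullet> b)) \<in> borel_measurable (lebesgue_on E)"
        using int by (rule borel_measurable_integrable)
      have "cutoff (\<delta> n) (1 - \<delta> n) \<in> borel_measurable (lebesgue_on E)" for n
        by (intro continuous_imp_measurable_lebesgue_on C_k_continuous_on[of 0] C_k_cutoff \<delta>)
      from borel_measurable_times[OF this borel_measurable_integrable[OF int]]
      show "(\<lambda>x. l x * cutoff (\<delta> n) (1 - \<delta> n) x * ((g x - h x) \<bullet> b)) \<in> borel_measurable (lebesgue_on E)" for n
        by (simp add: mult_ac)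
      show "integrable (lebesgue_on E) (\<lambda>x. \<bar>l x * ((g x - h x) \<bullet> b)\<bar>)"
        using int by (rule integrable_abs)
      show "AE x in lebesgue_on E. (\<lambda>n. l x * cutoff (\<delta> n) (1 - \<delta> n) x * ((g x - h x) \<bullet> b))
          \<longlonglongrightarrow> l x * ((g x - h x) \<bullet> b)"
      proof (rule AE_I2)
        fix x assume "x \<in> space (lebesgue_on E)"
        then have "1 - quad a x > 0" by (simp add: ellipsoid_def)
        from tendsto_mult[OF tendsto_mult[OF tendsto_const[of "l x"] flat_0_tendsto[OF lim limt this]] tendsto_const[of "(g x - h x) \<bullet> b"]]
        show "(\<lambda>n. l x * cutoff (\<delta> n) (1 - \<delta> n) x * ((g x - h x) \<bullet> b)) \<longlonglongrightarrow> l x * ((g x - h x) \<bullet> b)"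
          by (simp add: cutoff_def)
      qed
      show "AE x in lebesgue_on E. norm (l x * cutoff (\<delta> n) (1 - \<delta> n) x * ((g x - h x) \<bullet> b))
          \<le> \<bar>l x * ((g x - h x) \<bullet> b)\<bar>" for n
      proof (intro always_eventually allI)
        fix x
        have "\<bar>cutoff (\<delta> n) (1 - \<delta> n) x\<bar> \<le> 1"
          using flat_nonneg flat_0_le_1[OF \<delta>] by (simp add: cutoff_def)
        from mult_right_mono[OF this, of "\<bar>l x * ((g x - h x) \<bullet> b)\<bar>"]
        show "norm (l x * cutoff (\<delta> n) (1 - \<delta> n) x * ((g x - h x) \<bullet> b)) \<le> \<bar>l x * ((g x - h x) \<bullet> b)\<bar>"
          by (simp add: abs_mult mult_ac)
      qed
    qed
    then show "(LINT x|lebesgue_on E. (gradient torsion x \<bullet> b) * ((g x - h x) \<bullet> b)) = 0"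
      unfolding zero by (simp add: LIMSEQ_const_iff l_def)
  qed
  have "(LINT x|lebesgue_on E. gradient torsion x \<bullet> (g x - h x))
      = (LINT x|lebesgue_on E. (\<Sum>b\<in>Basis. (gradient torsion x \<bullet> b) * ((g x - h x) \<bullet> b)))"
    by (subst euclidean_inner) (rule refl)
  also have "\<dots> = 0"
    using int_comp comp by (simp add: Bochner_Integration.integral_sum)
  finally have "(LINT x|lebesgue_on E. gradient torsion x \<bullet> g x - gradient torsion x \<bullet> h x) = 0"
    by (simp add: inner_diff_right)
  then show ?thesis
    using L2_inner_integrable[OF gradient_L2[OF C_k_torsion]] gh by simp
qed

text \<open>The weak equation passes from test functions to \<open>H1_0\<close> by density: the
  integrals of \<open>\<phi> n\<close> tend both to the integral of \<open>v\<close> and to that of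
  \<open>gradient torsion x \<bullet> g x\<close>. The gradient \<open>g\<close> provided by
  \<open>H1_0\<close> may differ from the prescribed \<open>h\<close>; the uniqueness lemma
  exchanges them.\<close>

lemma torsion_function_torsion: "torsion_function E torsion"
  unfolding torsion_function_def
proof (intro conjI exI[of _ "gradient torsion"] ballI allI impI torsion_H1_0 torsion_has_weak_gradient)
  fix v h assume v: "v \<in> H1_0 E" and h: "has_weak_gradient E v h"
  obtain g \<phi> where g: "has_weak_gradient E v g" and \<phi>: "\<And>n. \<phi> n \<in> test_functions E"
    and lim: "(\<lambda>n. (LINT x|lebesgue_on E. (\<phi> n x - v x)\<^sup>2) +
             (LINT x|lebesgue_on E. (norm (gradient (\<phi> n) x - g x))\<^sup>2)) \<longlonglongrightarrow> 0"
    using v unfolding H1_0_def by blast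
  have vg: "v \<in> L2 E" "g \<in> L2 E" using g by (auto simp: has_weak_gradient_def)
  have lim1: "(\<lambda>n. LINT x|lebesgue_on E. (\<phi> n x - v x)\<^sup>2) \<longlonglongrightarrow> 0"
    by (rule tendsto_sandwich[OF _ _ tendsto_const lim]) (auto intro!: always_eventually)
  have lim2: "(\<lambda>n. LINT x|lebesgue_on E. (norm (gradient (\<phi> n) x - g x))\<^sup>2) \<longlonglongrightarrow> 0"
    by (rule tendsto_sandwich[OF _ _ tendsto_const lim]) (auto intro!: always_eventually)
  have one: "(\<lambda>x. 1::real) \<in> L2 E"
    by (intro continuous_in_L2 E_bounded E_lmeasurable continuous_on_const)
  \<comment> \<open>The ellipsoid has finite measure, so the integral itself is a pairing with the
    \<open>L2\<close> function 1.\<close>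
  have "(\<lambda>n. LINT x|lebesgue_on E. 1 \<bullet> (\<phi> n x - v x)) \<longlonglongrightarrow> 0"
    using lim1 by (intro L2_inner_tendsto_0[OF one] L2_diff test_function_L2 \<phi> vg) simp
  then have l1: "(\<lambda>n. (LINT x|lebesgue_on E. \<phi> n x) - (LINT x|lebesgue_on E. v x)) \<longlonglongrightarrow> 0"
    using L2_integrable_of_lmeasurable[OF test_function_L2[OF \<phi>] E_lmeasurable]
      L2_integrable_of_lmeasurable[OF vg(1) E_lmeasurable] by simp
  have gt: "gradient torsion \<in> L2 E" by (intro gradient_L2 C_k_torsion)
  have g\<phi>: "gradient (\<phi> n) \<in> L2 E" for n by (intro gradient_L2 test_functions_C_k[OF \<phi>])
  have "(\<lambda>n. LINT x|lebesgue_on E. gradient torsion x \<bullet> (gradient (\<phi> n) x - g x)) \<longlonglongrightarrow> 0"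
    using lim2 by (intro L2_inner_tendsto_0 L2_diff gt g\<phi> vg)
  then have l2: "(\<lambda>n. (LINT x|lebesgue_on E. \<phi> n x) - (LINT x|lebesgue_on E. gradient torsion x \<bullet> g x)) \<longlonglongrightarrow> 0"
    using L2_inner_integrable[OF gt g\<phi>] L2_inner_integrable[OF gt vg(2)]
    by (simp add: inner_diff_right integral_gradient_torsion_test[OF \<phi>])
  have "(LINT x|lebesgue_on E. gradient torsion x \<bullet> g x) = (LINT x|lebesgue_on E. v x)"
    using tendsto_diff[OF l1 l2] by (simp add: LIMSEQ_const_iff)
  then show "(LINT x|lebesgue_on E. gradient torsion x \<bullet> h x) = (LINT x|lebesgue_on E. v x)"
    using integral_gradient_torsion_unique[OF g h] by simp
qed

section \<open>Two-sided bounds for the torsional rigidity\<close>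

lemma integrable_torsion: "integrable (lebesgue_on E) torsion"
  by (intro integrable_on_bounded E_bounded E_lmeasurable C_k_continuous_on[of 0] C_k_torsion)

lemma integral_const_E: "(LINT x|lebesgue_on E. c :: real) = measure lebesgue E * c"
  using E_sets by (simp add: measure_restrict_space)

text \<open>The integrand is bounded by its value at the centre,
  \<open>1 / (2 * trace_inv)\<close>.\<close>

lemma torsional_rigidity_le: "torsional_rigidity E \<le> measure lebesgue E / (2 * trace_inv)"
proof -
  have "(LINT x|lebesgue_on E. torsion x) \<le> (LINT x|lebesgue_on E. 1 / (2 * trace_inv))"
    using trace_inv_pos quad_nonneg[of a]
    by (intro integral_mono integrable_torsion integrable_on_bounded E_bounded E_lmeasurable)
      (auto simp: torsion_def divide_right_mono)
  then show ?thesis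
    unfolding integral_const_E by (simp add: torsional_rigidity_eq[OF torsion_function_torsion])
qed

text \<open>On the ellipsoid shrunk by the factor \<open>1/2\<close>, \<open>torsion\<close> is at least \<open>3/4\<close> of its maximum.\<close>

lemma torsional_rigidity_ge:
  "torsional_rigidity E \<ge> 3 / (8 * 2 ^ DIM('a)) * measure lebesgue E / trace_inv"
proof -
  define H where "H = (*\<^sub>R) (1/2) ` E"
  have quadH: "quad a x < 1 / 4" if "x \<in> H" for x
    using that by (auto simp: H_def ellipsoid_def quad_scaleR power2_eq_square)
  have sub: "H \<subseteq> E" using quadH by (force simp: ellipsoid_def)
  have oH: "open H" unfolding H_def by (intro open_scaling open_ellipsoid) simp
  have mH: "measure lebesgue H = measure lebesgue E / 2 ^ DIM('a)"
    using measure_lebesgue_affine[of "1/2" 0 E] by (simp add: H_def power_divide)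
  have H: "H \<in> lmeasurable" by (rule lmeasurable_open[OF bounded_subset[OF E_bounded sub] oH])
  have "3 / (8 * 2 ^ DIM('a)) * measure lebesgue E / trace_inv = measure lebesgue H * (3 / (8 * trace_inv))"
    by (simp add: mH)
  also have "\<dots> = (LINT x|lebesgue. indicator H x * (3 / (8 * trace_inv)))"
    using H by (simp add: fmeasurableD)
  also have "\<dots> = (LINT x|lebesgue_on E. indicator H x * (3 / (8 * trace_inv)))"
    using sub by (intro integral_lebesgue_on_supp_subset[symmetric] E_sets) (auto simp: indicator_def)
  also have "\<dots> \<le> (LINT x|lebesgue_on E. torsion x)"
  proof (rule integral_mono)
    have "integrable lebesgue (\<lambda>x. indicator H x * (3 / (8 * trace_inv)))"
      using H by (intro integrable_mult_left integrable_real_indicator)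
         (auto simp: fmeasurable_def simp del: emeasure_completion)
    then show "integrable (lebesgue_on E) (\<lambda>x. indicator H x * (3 / (8 * trace_inv)))"
      by (intro integrable_lebesgue_on E_sets)
    fix x assume "x \<in> space (lebesgue_on E)"
    then have "quad a x < 1" by (simp add: ellipsoid_def)
    then show "indicator H x * (3 / (8 * trace_inv)) \<le> torsion x"
      using quadH[of x] trace_inv_pos
      by (cases "x \<in> H") (auto simp: torsion_def field_simps)
  qed (rule integrable_torsion)
  finally show ?thesis by (simp add: torsional_rigidity_eq[OF torsion_function_torsion])
qed

section \<open>Perimeter of ellipsoids\<close>

text \<open>The divergence is treated one coordinate at a time, each component of the field being
  bounded by 1. In the norm \<open>sqrt (quad a x)\<close> the vector \<open>t *\<^sub>R b\<close>
  has length \<open>t / a b\<close>, so \<open>E\<close> and its translate lie in the dilation by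
  \<open>1 + t / a b\<close>. For thin ellipsoids the small volume compensates the large sum of the
  \<open>1 / a b\<close>.\<close>

lemma perimeter_le: "perimeter E \<le> ereal (2 * DIM('a) * measure lebesgue E * (\<Sum>b\<in>Basis. 1 / a b))"
  unfolding perimeter_def
proof (rule SUP_least)
  fix \<phi> :: "'a \<Rightarrow> 'a"
  assume "\<phi> \<in> {\<phi>. C_k 1 \<phi> \<and> compact (supp \<phi>) \<and> (AE x in lebesgue. norm (\<phi> x) \<le> 1)}"
  then have \<phi>: "C_k 1 \<phi>" and supp: "compact (supp \<phi>)" and le: "AE x in lebesgue. norm (\<phi> x) \<le> 1"
    by blast+
  have C: "C_k 1 (\<lambda>x. \<phi> x \<bullet> b)" for b
    by (rule C_k_bounded_linear_compose[OF bounded_linear_inner_left \<phi>])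
  have D: "frechet_derivative (\<lambda>x. \<phi> x \<bullet> b) (at x) = (\<lambda>v. frechet_derivative \<phi> (at x) v \<bullet> b)" for b x
    using C_k_Suc_has_derivative[of 0 \<phi> x] \<phi>
    by (intro frechet_derivative_at[symmetric] has_derivative_inner_left) simp
  have supp_b: "compact (supp (\<lambda>x. \<phi> x \<bullet> b))" for b
    by (rule compact_supp_subset[OF _ supp]) (auto simp: supp_def intro!: closure_mono)
  have int: "integrable (lebesgue_on E) (\<lambda>x. frechet_derivative \<phi> (at x) b \<bullet> b)" for b
    using \<phi> by (intro integrable_on_bounded E_bounded E_lmeasurable continuous_intros) simp
  have "(LINT x|lebesgue_on E. divergence \<phi> x) = (\<Sum>b\<in>Basis. LINT x|lebesgue_on E. frechet_derivative \<phi> (at x) b \<bullet> b)"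
    unfolding divergence_def using int by (rule Bochner_Integration.integral_sum)
  also have "\<dots> \<le> (\<Sum>b\<in>Basis. 2 * (1 / a b) * DIM('a) * measure lebesgue E)"
  proof (rule sum_mono)
    fix b :: 'a assume b: "b \<in> Basis"
    note ab = axes_pos[OF b]
    have le_b: "AE x in lebesgue. \<bar>\<phi> x \<bullet> b\<bar> \<le> 1"
      using le by eventually_elim (use Basis_le_norm[OF b] order_trans in blast)
    have "quad a b = (\<Sum>i\<in>Basis. if i = b then 1 / (a b)\<^sup>2 else 0)"
      unfolding quad_def using b by (intro sum.cong) (auto simp: inner_Basis power_divide)
    then have qb: "sqrt (quad a (t *\<^sub>R b)) = t * (1 / a b)" if "t > 0" for t
      using b ab that by (simp add: quad_scaleR real_sqrt_mult real_sqrt_divide)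
    have mem: "y \<in> (*\<^sub>R) r ` E" if "r > 0" "sqrt (quad a y) < r" for y r
    proof (rule image_eqI[where x = "inverse r *\<^sub>R y"])
      have "quad a y < r\<^sup>2" using that real_sqrt_less_iff[of "quad a y" "r\<^sup>2"] by simp
      then show "inverse r *\<^sub>R y \<in> E"
        using that by (simp add: ellipsoid_def quad_scaleR power_inverse inverse_eq_divide divide_simps)
    qed (use that in simp)
    have "(LINT x|lebesgue_on E. frechet_derivative (\<lambda>x. \<phi> x \<bullet> b) (at x) b) \<le> 2 * (1 / a b) * DIM('a) * measure lebesgue E"
    proof (rule integral_partial_derivative_le[OF C supp_b le_b open_ellipsoid E_lmeasurable])
      show "0 \<le> 1 / a b" using ab by simp
      fix t :: real and x assume t: "t > 0" and "x \<in> E"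
      then have x: "sqrt (quad a x) < 1" by (simp add: ellipsoid_def)
      have r: "0 < 1 + t * (1 / a b)" and "0 < t * (1 / a b)" using t ab by (auto intro: add_pos_pos)
      with x show "x \<in> (*\<^sub>R) (1 + t * (1 / a b)) ` E" by (intro mem) linarith+
      show "x + t *\<^sub>R b \<in> (*\<^sub>R) (1 + t * (1 / a b)) ` E"
        using sqrt_quad_triangle[of a x "t *\<^sub>R b"] qb[OF t] x r by (intro mem) linarith+
    qed
    then show "(LINT x|lebesgue_on E. frechet_derivative \<phi> (at x) b \<bullet> b) \<le> 2 * (1 / a b) * DIM('a) * measure lebesgue E"
      by (simp add: D)
  qed
  also have "\<dots> = 2 * DIM('a) * measure lebesgue E * (\<Sum>b\<in>Basis. 1 / a b)"
    by (simp add: sum_distrib_left mult_ac)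
  finally show "ereal (LINT x|lebesgue_on E. divergence \<phi> x) \<le> ereal (2 * DIM('a) * measure lebesgue E * (\<Sum>b\<in>Basis. 1 / a b))"
    by simp
qed

text \<open>The competitor is \<open>(x \<bullet> b / (2 a\<^sub>b)) b\<close>, cut off smoothly between the ellipsoid and its dilation by
  \<open>\<surd>2\<close>.\<close>

lemma perimeter_ge:
  assumes b: "b \<in> Basis"
  shows "perimeter E \<ge> ereal (3 / 16 * measure lebesgue E / a b)"
proof -
  note ab = axes_pos[OF b]
  \<comment> \<open>On the support \<open>\<bar>x \<bullet> b\<bar> \<le> 2 * a b\<close>, so the
    factor \<open>1/2\<close> keeps the field within norm 1. On \<open>E\<close> the argument
    \<open>2 - quad a x\<close> of the flat profile is at least 1, and \<open>1/4\<close> then keeps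
    the cutoff above \<open>3/4\<close>.\<close>
  define s where "s x = 1 / (2 * a b) * (x \<bullet> b) * cutoff (1/4) 2 x" for x
  define \<phi> where "\<phi> x = s x *\<^sub>R b" for x
  have sC: "C_k k s" for k
    unfolding s_def[abs_def] by (intro C_k_mult C_k_cmult C_k_component C_k_cutoff) simp
  have \<phi>C: "C_k 1 \<phi>"
    unfolding \<phi>_def[abs_def] by (rule C_k_bounded_linear_compose[OF bounded_linear_scaleR_left sC])
  have "supp \<phi> = supp s"
    using b by (simp add: supp_def \<phi>_def nonzero_Basis)
  then have \<phi>supp: "compact (supp \<phi>)"
    using compact_supp_cutoff[of "\<lambda>x. 1 / (2 * a b) * (x \<bullet> b)" "1/4" 2] by (simp add: s_def[abs_def])
  have \<phi>le: "norm (\<phi> x) \<le> 1" for x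
  proof (cases "quad a x < 2")
    case True
    have "(x \<bullet> b / a b)\<^sup>2 \<le> 2\<^sup>2" using component_le_quad[OF b, of x a] True by simp
    then have "\<bar>x \<bullet> b / a b\<bar> \<le> 2" using abs_le_square_iff[of "x \<bullet> b / a b" 2] by simp
    moreover have "\<bar>cutoff (1/4) 2 x\<bar> \<le> 1"
      using flat_nonneg flat_0_le_1[of "1/4"] by (simp add: cutoff_def)
    ultimately have "\<bar>x \<bullet> b / a b\<bar> * \<bar>cutoff (1/4) 2 x\<bar> \<le> 2 * 1" by (intro mult_mono) auto
    then show ?thesis using b ab by (simp add: \<phi>_def s_def abs_mult field_simps)
  next
    case False
    then show ?thesis by (simp add: \<phi>_def s_def cutoff_def flat_def)
  qed
  have div: "divergence \<phi> x \<ge> 3 / (16 * a b)" and div': "divergence \<phi> x = frechet_derivative s (at x) b"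
    if "x \<in> E" for x
  proof -
    have ds: "(s has_derivative frechet_derivative s (at x)) (at x)"
      by (rule C_k_Suc_has_derivative[OF sC])
    have "(\<phi> has_derivative (\<lambda>v. frechet_derivative s (at x) v *\<^sub>R b)) (at x)"
      unfolding \<phi>_def[abs_def] by (rule has_derivative_scaleR_left[OF ds])
    from frechet_derivative_at[OF this, symmetric]
    have "divergence \<phi> x = (\<Sum>i\<in>Basis. if i = b then frechet_derivative s (at x) b else 0)"
      unfolding divergence_def using b by (intro sum.cong) (auto simp: inner_Basis)
    then show div': "divergence \<phi> x = frechet_derivative s (at x) b" using b by simp
    define t where "t = 2 - quad a x"
    let ?D = "frechet_derivative (quad a) (at x)"
    have t: "t \<ge> 1" using that by (simp add: t_def ellipsoid_def)
    have 1: "((\<lambda>x. 2 - quad a x) has_derivative (\<lambda>v. - ?D v)) (at x)"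
      using has_derivative_diff[OF has_derivative_const quad_has_frechet_derivative, of 2] by simp
    have "(flat (1/4) 0 has_real_derivative 1/4 * flat (1/4) 2 t) (at t)"
      using flat_has_real_derivative[of "1/4" 0 t] by (simp add: numeral_2_eq_2)
    from has_derivative_compose[OF 1 this[unfolded has_field_derivative_def t_def]]
    have 2: "(cutoff (1/4) 2 has_derivative (\<lambda>v. 1/4 * flat (1/4) 2 t * - ?D v)) (at x)"
      by (simp add: cutoff_def[abs_def] t_def)
    have 3: "((\<lambda>x. 1 / (2 * a b) * (x \<bullet> b)) has_derivative (\<lambda>v. 1 / (2 * a b) * (v \<bullet> b))) (at x)"
      by (intro has_derivative_mult_right bounded_linear_imp_has_derivative bounded_linear_inner_left)
    have "frechet_derivative s (at x) b =
       1 / (2 * a b) * (x \<bullet> b) * (1/4 * flat (1/4) 2 t * - ?D b) + 1 / (2 * a b) * (b \<bullet> b) * flat (1/4) 0 t"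
      using frechet_derivative_at[OF has_derivative_mult[OF 3 2], symmetric]
      by (simp add: s_def[abs_def] cutoff_def t_def)
    also have "\<dots> = 1 / (2 * a b) * (flat (1/4) 0 t - (x \<bullet> b / a b)\<^sup>2 * flat (1/4) 2 t / 2)"
      using ab b by (simp add: partial_derivative_quad field_simps power2_eq_square)
    finally have eq: "frechet_derivative s (at x) b =
       1 / (2 * a b) * (flat (1/4) 0 t - (x \<bullet> b / a b)\<^sup>2 * flat (1/4) 2 t / 2)" .
    \<comment> \<open>The cutoff decreases outwards, which costs the subtracted term. As
      \<open>t \<ge> 1\<close>, this term is at most half of \<open>flat (1/4) 0 t\<close>; the
      other half is at least \<open>3/8\<close>, and the factor \<open>1 / (2 * a b)\<close> turns
      it into \<open>3 / (16 * a b)\<close>.\<close>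
    have "flat (1/4) 2 t \<le> flat (1/4) 0 t"
      using t by (simp add: flat_def divide_le_eq mult_le_cancel_left1)
    moreover have "(x \<bullet> b / a b)\<^sup>2 \<le> 1"
      using component_le_quad[OF b, of x a] that by (simp add: ellipsoid_def)
    ultimately have "(x \<bullet> b / a b)\<^sup>2 * flat (1/4) 2 t \<le> 1 * flat (1/4) 0 t"
      by (intro mult_mono flat_nonneg) auto
    moreover have "flat (1/4) 0 t \<ge> 3 / 4"
    proof -
      have "3 / 4 \<le> 1 + (- (1/4) / t)" using t by (simp add: field_simps)
      also have "\<dots> \<le> exp (- (1/4) / t)" by (rule exp_ge_add_one_self)
      finally show ?thesis using t by (simp add: flat_def)
    qed
    ultimately have "3 / 8 \<le> flat (1/4) 0 t - (x \<bullet> b / a b)\<^sup>2 * flat (1/4) 2 t / 2" by simp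
    then have "1 / (2 * a b) * (3 / 8) \<le> 1 / (2 * a b) * (flat (1/4) 0 t - (x \<bullet> b / a b)\<^sup>2 * flat (1/4) 2 t / 2)"
      using ab by (intro mult_left_mono) auto
    then show "divergence \<phi> x \<ge> 3 / (16 * a b)" by (simp add: div' eq)
  qed
  have "3 / 16 * measure lebesgue E / a b = (LINT x|lebesgue_on E. 3 / (16 * a b))"
    unfolding integral_const_E by simp
  also have "\<dots> \<le> (LINT x|lebesgue_on E. divergence \<phi> x)"
  proof (rule integral_mono)
    show "integrable (lebesgue_on E) (\<lambda>x. divergence \<phi> x)"
      unfolding divergence_def using \<phi>C
      by (intro integrable_on_bounded E_bounded E_lmeasurable continuous_intros) auto
    show "integrable (lebesgue_on E) (\<lambda>x. 3 / (16 * a b))"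
      by (intro integrable_on_bounded E_bounded E_lmeasurable continuous_on_const)
  qed (use div in simp)
  also have "ereal (LINT x|lebesgue_on E. divergence \<phi> x) \<le> perimeter E"
    unfolding perimeter_def using \<phi>C \<phi>supp \<phi>le by (intro SUP_upper) auto
  finally show ?thesis by simp
qed

end

section \<open>Thin ellipsoids\<close>

definition thin :: "'a::euclidean_space \<Rightarrow> real \<Rightarrow> 'a \<Rightarrow> real" where
  "thin b0 \<epsilon> b = (if b = b0 then \<epsilon> else 1)"

text \<open>The short axis contributes the largest of the \<open>d\<close> terms. The power
  \<open>k = 2\<close> is used for \<open>trace_inv\<close>, \<open>k = 1\<close> for the
  perimeter.\<close>

lemma sum_thin:
  fixes b0 :: "'a::euclidean_space"
  assumes "b0 \<in> Basis" "0 < \<epsilon>" "\<epsilon> \<le> 1"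
  shows "1 / \<epsilon> ^ k \<le> (\<Sum>b\<in>Basis. 1 / (thin b0 \<epsilon> b) ^ k)" "(\<Sum>b\<in>Basis. 1 / (thin b0 \<epsilon> b) ^ k) \<le> DIM('a) / \<epsilon> ^ k"
proof -
  have "1 / (thin b0 \<epsilon> b0) ^ k \<le> (\<Sum>b\<in>Basis. 1 / (thin b0 \<epsilon> b) ^ k)"
    using assms by (intro member_le_sum) (auto simp: thin_def)
  then show "1 / \<epsilon> ^ k \<le> (\<Sum>b\<in>Basis. 1 / (thin b0 \<epsilon> b) ^ k)" by (simp add: thin_def)
  have "(\<Sum>b\<in>Basis. 1 / (thin b0 \<epsilon> b) ^ k) \<le> (\<Sum>b\<in>(Basis::'a set). 1 / \<epsilon> ^ k)"
    using assms by (intro sum_mono) (auto simp: thin_def power_le_one)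
  then show "(\<Sum>b\<in>Basis. 1 / (thin b0 \<epsilon> b) ^ k) \<le> DIM('a) / \<epsilon> ^ k" by simp
qed

text \<open>\<open>trace_inv\<close> is of order \<open>1 / \<epsilon>^2\<close>, which turns the
  volume of order \<open>\<epsilon>\<close> into a rigidity of order \<open>\<epsilon>^3\<close>. In
  the perimeter bounds the volume cancels a factor \<open>1 / \<epsilon>\<close>; from below this
  needs the field along the short axis \<open>b0\<close>.\<close>

lemma thin_ellipsoid_estimates:
  fixes b0 :: "'a::euclidean_space"
  assumes b0: "b0 \<in> Basis" and \<epsilon>: "0 < \<epsilon>" "\<epsilon> \<le> 1"
  defines "\<omega> \<equiv> measure lebesgue (ball 0 1 :: 'a set)" and "d \<equiv> real DIM('a)" and "\<Omega> \<equiv> ellipsoid (thin b0 \<epsilon>)"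
  shows "measure lebesgue \<Omega> = \<epsilon> * \<omega>"
    and "torsional_rigidity \<Omega> \<le> \<omega> / 2 * \<epsilon> ^ 3"
    and "torsional_rigidity \<Omega> \<ge> 3 / (8 * 2 ^ DIM('a) * d) * \<omega> * \<epsilon> ^ 3"
    and "perimeter \<Omega> \<le> ereal (2 * d\<^sup>2 * \<omega>)"
    and "perimeter \<Omega> \<ge> ereal (3 / 16 * \<omega>)"
    and "\<Omega> \<in> A_convex"
proof -
  interpret ellipsoid_axes "thin b0 \<epsilon>"
    by unfold_locales (use \<epsilon> in \<open>simp add: thin_def\<close>)
  have d: "d > 0" by (simp add: d_def)
  have \<omega>: "\<omega> > 0" using content_ball_pos[of 1 "0 :: 'a"] by (simp add: \<omega>_def)
  have "(\<Prod>b\<in>Basis. thin b0 \<epsilon> b) = \<epsilon>"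
    unfolding thin_def using b0 by simp
  then show m: "measure lebesgue \<Omega> = \<epsilon> * \<omega>"
    unfolding \<Omega>_def \<omega>_def by (simp add: measure_ellipsoid[OF axes_pos])
  have tr: "1 / \<epsilon>\<^sup>2 \<le> trace_inv" "trace_inv \<le> d / \<epsilon>\<^sup>2"
    using sum_thin[OF b0 \<epsilon>, of 2] by (simp_all add: trace_inv_def d_def)
  have "torsional_rigidity \<Omega> \<le> \<epsilon> * \<omega> / (2 * trace_inv)"
    using torsional_rigidity_le m by (simp add: \<Omega>_def)
  also have "\<dots> \<le> \<epsilon> * \<omega> / (2 * (1 / \<epsilon>\<^sup>2))"
    using tr \<epsilon> \<omega> trace_inv_pos by (intro divide_left_mono mult_pos_pos) auto
  also have "\<dots> = \<omega> / 2 * \<epsilon> ^ 3" by (simp add: power2_eq_square power3_eq_cube)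
  finally show "torsional_rigidity \<Omega> \<le> \<omega> / 2 * \<epsilon> ^ 3" .
  have "3 / (8 * 2 ^ DIM('a) * d) * \<omega> * \<epsilon> ^ 3 = 3 / (8 * 2 ^ DIM('a)) * (\<epsilon> * \<omega>) / (d / \<epsilon>\<^sup>2)"
    using \<epsilon> d by (simp add: power2_eq_square power3_eq_cube)
  also have "\<dots> \<le> 3 / (8 * 2 ^ DIM('a)) * (\<epsilon> * \<omega>) / trace_inv"
    using tr \<epsilon> \<omega> d trace_inv_pos by (intro divide_left_mono mult_nonneg_nonneg mult_pos_pos) auto
  also have "\<dots> \<le> torsional_rigidity \<Omega>"
    using torsional_rigidity_ge m by (simp add: \<Omega>_def)
  finally show "torsional_rigidity \<Omega> \<ge> 3 / (8 * 2 ^ DIM('a) * d) * \<omega> * \<epsilon> ^ 3" .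
  have "2 * d * (\<epsilon> * \<omega>) * (\<Sum>b\<in>Basis. 1 / thin b0 \<epsilon> b) \<le> 2 * d * (\<epsilon> * \<omega>) * (d / \<epsilon>)"
    using sum_thin(2)[OF b0 \<epsilon>, of 1] \<epsilon> \<omega> d by (intro mult_left_mono) (auto simp: d_def)
  also have "\<dots> = 2 * d\<^sup>2 * \<omega>" using \<epsilon> by (simp add: power2_eq_square)
  finally have "2 * d * measure lebesgue \<Omega> * (\<Sum>b\<in>Basis. 1 / thin b0 \<epsilon> b) \<le> 2 * d\<^sup>2 * \<omega>"
    by (simp add: m)
  moreover have "perimeter \<Omega> \<le> ereal (2 * d * measure lebesgue \<Omega> * (\<Sum>b\<in>Basis. 1 / thin b0 \<epsilon> b))"
    using perimeter_le by (simp add: \<Omega>_def d_def)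
  ultimately show "perimeter \<Omega> \<le> ereal (2 * d\<^sup>2 * \<omega>)"
    by (meson ereal_less_eq(3) order_trans)
  show "perimeter \<Omega> \<ge> ereal (3 / 16 * \<omega>)"
    using perimeter_ge[OF b0] m \<epsilon> by (simp add: \<Omega>_def thin_def)
  show "\<Omega> \<in> A_convex"
    using open_ellipsoid[of "thin b0 \<epsilon>"] convex_ellipsoid[of "thin b0 \<epsilon>"] zero_in_ellipsoid[of "thin b0 \<epsilon>"] E_lmeasurable
    unfolding A_convex_def \<Omega>_def by (auto simp: fmeasurable_def)
qed

section \<open>Scaling of \<open>F\<close> on thin ellipsoids\<close>

lemma perimeter_nonneg: "perimeter \<Omega> \<ge> 0"
proof -
  have "divergence (\<lambda>x. 0 :: 'a) x = 0" for x :: 'a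
    by (simp add: divergence_def frechet_derivative_const)
  then have "ereal 0 = ereal (LINT x|lebesgue_on \<Omega>. divergence (\<lambda>x. 0) x)" by simp
  also have "\<dots> \<le> perimeter \<Omega>"
    unfolding perimeter_def by (intro SUP_upper) (auto simp: C_k_const supp_def simp del: C_k.simps One_nat_def)
  finally show ?thesis by (simp add: zero_ereal_def)
qed

text \<open>The zero field competes in the perimeter, and the values of \<open>powr\<close> are
  nonnegative. This is the lower half of the claim on the infimum.\<close>

lemma F_nonneg: "F q \<Omega> \<ge> 0"
  unfolding F_def by (intro zero_le_divide_ereal ereal_0_le_mult perimeter_nonneg) simp_all

text \<open>The exponent is \<open>3 * q - \<alpha>\<close> with \<open>\<alpha>\<close> the power
  of the volume. \<open>C\<close> stands for the constant of either the lower or the upper bound on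
  the rigidity.\<close>

lemma F_exponent:
  fixes C T \<omega> \<epsilon> q d :: real
  assumes "0 < C" "0 < \<omega>" "0 < \<epsilon>"
  shows "(C * \<epsilon> ^ 3) powr q / (\<epsilon> * \<omega>) powr (1 + q + (2 * q - 1) / d)
    = C powr q / \<omega> powr (1 + q + (2 * q - 1) / d) * \<epsilon> powr ((2 * q - 1) * (1 - 1 / d))"
proof -
  define \<alpha> where "\<alpha> = 1 + q + (2 * q - 1) / d"
  have "\<epsilon> ^ 3 = \<epsilon> powr 3" using assms by simp
  then have "(C * \<epsilon> ^ 3) powr q = C powr q * \<epsilon> powr (3 * q)"
    using assms by (simp only: powr_mult powr_powr)
  moreover have "(\<epsilon> * \<omega>) powr \<alpha> = \<epsilon> powr \<alpha> * \<omega> powr \<alpha>"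
    using assms by (simp add: powr_mult)
  moreover have "(2 * q - 1) * (1 - 1 / d) = 3 * q - \<alpha>"
    by (simp add: \<alpha>_def algebra_simps diff_divide_distrib)
  ultimately show ?thesis
    by (simp add: powr_diff flip: \<alpha>_def)
qed

lemma F_eq_ereal:
  assumes "perimeter (\<Omega> :: 'a::euclidean_space set) = ereal p" "measure lebesgue \<Omega> > 0"
  shows "F q \<Omega> = ereal (p * (torsional_rigidity \<Omega> powr q / measure lebesgue \<Omega> powr (1 + q + (2 * q - 1) / DIM('a))))"
  using assms by (simp add: F_def)

text \<open>The constants depend on \<open>q\<close> and the dimension but not on
  \<open>\<epsilon>\<close>; the upper bound serves the infimum, the lower one the supremum. That
  \<open>q\<close> is positive lets bounds on the rigidity pass to its power
  \<open>q\<close>.\<close>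

lemma F_thin_ellipsoid:
  fixes b0 :: "'a::euclidean_space"
  assumes b0: "b0 \<in> Basis" and q: "q > 0"
  shows "\<exists>c C. c > 0 \<and> C > 0 \<and> (\<forall>\<epsilon>. 0 < \<epsilon> \<and> \<epsilon> \<le> 1 \<longrightarrow>
       ereal (c * \<epsilon> powr ((2 * q - 1) * (1 - 1 / DIM('a)))) \<le> F q (ellipsoid (thin b0 \<epsilon>)) \<and>
       F q (ellipsoid (thin b0 \<epsilon>)) \<le> ereal (C * \<epsilon> powr ((2 * q - 1) * (1 - 1 / DIM('a)))))"
proof -
  define \<omega> where "\<omega> = measure lebesgue (ball 0 1 :: 'a set)"
  define d where "d = real DIM('a)"
  define \<alpha> where "\<alpha> = 1 + q + (2 * q - 1) / d"
  define \<beta> where "\<beta> = (2 * q - 1) * (1 - 1 / d)"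
  define K where "K = 3 / (8 * 2 ^ DIM('a) * d) * \<omega>"
  have d: "d > 0" by (simp add: d_def)
  have \<omega>: "\<omega> > 0" using content_ball_pos[of 1 "0 :: 'a"] by (simp add: \<omega>_def)
  have K: "K > 0" using d \<omega> by (simp add: K_def)
  define c where "c = 3 / 16 * \<omega> * (K powr q / \<omega> powr \<alpha>)"
  define C where "C = 2 * d\<^sup>2 * \<omega> * ((\<omega> / 2) powr q / \<omega> powr \<alpha>)"
  show ?thesis
  proof (intro exI conjI allI impI; (elim conjE)?)
    show "c > 0" "C > 0" using d \<omega> K by (simp_all add: c_def C_def)
    fix \<epsilon> :: real assume \<epsilon>: "0 < \<epsilon>" "\<epsilon> \<le> 1"
    define \<Omega> where "\<Omega> = ellipsoid (thin b0 \<epsilon>)"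
    define T where "T = torsional_rigidity \<Omega>"
    note est = thin_ellipsoid_estimates[OF b0 \<epsilon>, folded \<omega>_def d_def \<Omega>_def]
    have P: "ereal (3 / 16 * \<omega>) \<le> perimeter \<Omega>" "perimeter \<Omega> \<le> ereal (2 * d\<^sup>2 * \<omega>)" by (fact est)+
    obtain p where p: "perimeter \<Omega> = ereal p" using P by (cases "perimeter \<Omega>") auto
    have p_bd: "3 / 16 * \<omega> \<le> p" "p \<le> 2 * d\<^sup>2 * \<omega>" using P by (simp_all add: p)
    have T_bd: "K * \<epsilon> ^ 3 \<le> T" "T \<le> \<omega> / 2 * \<epsilon> ^ 3" using est by (simp_all add: T_def K_def)
    have K\<epsilon>: "0 \<le> K * \<epsilon> ^ 3" using K \<epsilon> by simp
    have F: "F q \<Omega> = ereal (p * (T powr q / (\<epsilon> * \<omega>) powr \<alpha>))"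
      using F_eq_ereal[OF p, of q] est(1) \<epsilon> \<omega> by (simp add: T_def \<alpha>_def d_def)
    have "c * \<epsilon> powr \<beta> = 3 / 16 * \<omega> * ((K * \<epsilon> ^ 3) powr q / (\<epsilon> * \<omega>) powr \<alpha>)"
      unfolding c_def \<alpha>_def \<beta>_def F_exponent[OF K \<omega> \<epsilon>(1)] by simp
    also have "\<dots> \<le> p * (T powr q / (\<epsilon> * \<omega>) powr \<alpha>)"
      using p_bd \<omega> T_bd K\<epsilon> q by (intro mult_mono divide_right_mono powr_mono2) auto
    finally have lower: "c * \<epsilon> powr \<beta> \<le> p * (T powr q / (\<epsilon> * \<omega>) powr \<alpha>)" .
    have "p * (T powr q / (\<epsilon> * \<omega>) powr \<alpha>) \<le> 2 * d\<^sup>2 * \<omega> * ((\<omega> / 2 * \<epsilon> ^ 3) powr q / (\<epsilon> * \<omega>) powr \<alpha>)"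
      using p_bd \<omega> T_bd K\<epsilon> q by (intro mult_mono divide_right_mono powr_mono2) auto
    also have "\<dots> = C * \<epsilon> powr \<beta>"
      using F_exponent[of "\<omega> / 2" \<omega> \<epsilon> q d] \<omega> \<epsilon> by (simp add: C_def \<alpha>_def \<beta>_def)
    finally have upper: "p * (T powr q / (\<epsilon> * \<omega>) powr \<alpha>) \<le> C * \<epsilon> powr \<beta>" .
    from lower upper
    show "ereal (c * \<epsilon> powr ((2 * q - 1) * (1 - 1 / DIM('a)))) \<le> F q (ellipsoid (thin b0 \<epsilon>))"
      and "F q (ellipsoid (thin b0 \<epsilon>)) \<le> ereal (C * \<epsilon> powr ((2 * q - 1) * (1 - 1 / DIM('a))))"
      unfolding \<Omega>_def[symmetric] F by (simp_all add: \<beta>_def d_def)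
  qed
qed

section \<open>The infimum and the supremum\<close>

lemma INF_F_eq_0:
  assumes "DIM('a::euclidean_space) \<ge> 2" "q > 1 / 2"
  shows "(INF \<Omega> \<in> (A_convex :: 'a set set). F q \<Omega>) = 0"
proof (rule antisym)
  define \<beta> where "\<beta> = (2 * q - 1) * (1 - 1 / DIM('a))"
  have \<beta>: "\<beta> > 0" using assms by (simp add: \<beta>_def)
  obtain b0 :: 'a where b0: "b0 \<in> Basis" using nonempty_Basis by blast
  have "q > 0" using assms by simp
  obtain C where C: "C > 0"
    "\<And>\<epsilon>. 0 < \<epsilon> \<Longrightarrow> \<epsilon> \<le> 1 \<Longrightarrow> F q (ellipsoid (thin b0 \<epsilon>)) \<le> ereal (C * \<epsilon> powr \<beta>)"
    using F_thin_ellipsoid[OF b0 \<open>q > 0\<close>, folded \<beta>_def] by blast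
  show "(INF \<Omega> \<in> (A_convex :: 'a set set). F q \<Omega>) \<le> 0"
  proof (rule ereal_le_epsilon2)
    fix e :: real assume e: "0 < e"
    \<comment> \<open>\<open>\<epsilon>\<close> solves
      \<open>C * \<epsilon> powr \<beta> = e'\<close>; the minimum with \<open>C\<close> ensures
      \<open>\<epsilon> \<le> 1\<close>.\<close>
    define e' where "e' = min C e"
    define \<epsilon> where "\<epsilon> = (e' / C) powr (1 / \<beta>)"
    have e': "0 < e'" "e' \<le> C" "e' \<le> e" using C e by (auto simp: e'_def)
    have \<epsilon>: "0 < \<epsilon>" "\<epsilon> \<le> 1" using e' C \<beta> by (auto simp: \<epsilon>_def intro: powr_le1)
    have "(INF \<Omega> \<in> (A_convex :: 'a set set). F q \<Omega>) \<le> F q (ellipsoid (thin b0 \<epsilon>))"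
      by (intro INF_lower thin_ellipsoid_estimates b0 \<epsilon>)
    also have "\<dots> \<le> ereal (C * \<epsilon> powr \<beta>)" by (intro C \<epsilon>)
    also have "C * \<epsilon> powr \<beta> = e'" using e' C \<beta> by (simp add: \<epsilon>_def powr_powr)
    finally show "(INF \<Omega> \<in> (A_convex :: 'a set set). F q \<Omega>) \<le> 0 + ereal e"
      using e' by (simp add: order_trans)
  qed
qed (intro INF_greatest F_nonneg)

lemma SUP_F_eq_infinity:
  assumes "DIM('a::euclidean_space) \<ge> 2" "0 < q" "q < 1 / 2"
  shows "(SUP \<Omega> \<in> (A_convex :: 'a set set). F q \<Omega>) = \<infinity>"
proof (rule ereal_top)
  define \<beta> where "\<beta> = (2 * q - 1) * (1 - 1 / DIM('a))"
  have \<beta>: "\<beta> < 0" using assms by (simp add: \<beta>_def mult_neg_pos)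
  obtain b0 :: 'a where b0: "b0 \<in> Basis" using nonempty_Basis by blast
  obtain c where c: "c > 0"
    "\<And>\<epsilon>. 0 < \<epsilon> \<Longrightarrow> \<epsilon> \<le> 1 \<Longrightarrow> ereal (c * \<epsilon> powr \<beta>) \<le> F q (ellipsoid (thin b0 \<epsilon>))"
    using F_thin_ellipsoid[OF b0 assms(2), folded \<beta>_def] by blast
  fix B :: real
  \<comment> \<open>\<open>\<epsilon>\<close> solves
    \<open>c * \<epsilon> powr \<beta> = B'\<close>; since \<open>\<beta>\<close> is negative here,
    \<open>B' \<ge> c\<close> ensures \<open>\<epsilon> \<le> 1\<close>.\<close>
  define B' where "B' = max c B"
  define \<epsilon> where "\<epsilon> = (c / B') powr (- 1 / \<beta>)"
  have B': "c \<le> B'" "B \<le> B'" "0 < B'" using c by (auto simp: B'_def)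
  have \<epsilon>: "0 < \<epsilon>" "\<epsilon> \<le> 1" using B' c \<beta> by (auto simp: \<epsilon>_def divide_nonpos_neg intro!: powr_le1)
  have "\<epsilon> powr \<beta> = (c / B') powr (- 1)" using \<beta> by (simp add: \<epsilon>_def powr_powr)
  also have "\<dots> = B' / c" using B' c by (simp add: powr_minus)
  finally have "ereal B \<le> ereal (c * \<epsilon> powr \<beta>)" using B' c by simp
  also have "\<dots> \<le> F q (ellipsoid (thin b0 \<epsilon>))" by (intro c \<epsilon>)
  also have "\<dots> \<le> (SUP \<Omega> \<in> (A_convex :: 'a set set). F q \<Omega>)"
    by (intro SUP_upper thin_ellipsoid_estimates b0 \<epsilon>)
  finally show "ereal B \<le> (SUP \<Omega> \<in> (A_convex :: 'a set set). F q \<Omega>)" .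
qed

theorem proposition3p1:
  assumes "CARD('n::finite) \<ge> 2"
  shows "(\<forall>q::real. q > 1/2 \<longrightarrow> (INF \<Omega> \<in> (A_convex :: (real ^ 'n) set set). F q \<Omega>) = 0) \<and>
         (\<forall>q::real. 0 < q \<and> q < 1/2 \<longrightarrow> (SUP \<Omega> \<in> (A_convex :: (real ^ 'n) set set). F q \<Omega>) = \<infinity>)"
  using assms by (auto intro!: INF_F_eq_0 SUP_F_eq_infinity)

end
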